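(* Let $\Omega$ be an angular domain with $\Omega_I=\{re^{I(\zeta_I+\vartheta)}: r>0,\ |\vartheta|<\varphi_I/2\}$ for all $I\in\mathbb{S}$. Let $\rho>0$ and let $f$ be a slice regular function on $\Omega$, continuous on $\overline\Omega$, of order $\rho$ and type $\sigma$. If the opening of $\Omega$ is at most $\pi/\rho$ and $|f|\le M$ on $\partial\Omega$, then for every $I\in\mathbb{S}$, $$|f(re^{I(\zeta_I+\vartheta)})|\le M e^{\sigma r^\rho\cos(\rho\vartheta)}$$ for all $r>0$ and $|\vartheta|<\varphi_I/2$.
   Context: $\mathbb{H}$ denotes the quaternions with Euclidean norm $|q|$; $\mathbb{S}=\{ix_1+jx_2+kx_3: x_1^2+x_2^2+x_3^2=1\}$; for $I\in\mathbb{S}$, $L_I=\mathbb{R}+\mathbb{R}I$, $e^{I\vartheta}=\cos\vartheta+I\sin\vartheta$, and $\Omega_I=\Omega\cap L_I$. A function $f:\Omega\to\mathbb{H}$ on an open set $\Omega$ is slice regular if for every $I\in\mathbb{S}$ its restriction $f_I$ to $\Omega_I$ satisfies $\frac12\left(\frac{\partial}{\partial x}+I\frac{\partial}{\partial y}\right)f_I(x+yI)=0$. A domain $\Omega$ is a slice domain if $\Omega\cap\mathbb{R}\ne\emptyset$ and each $\Omega_I$ is a domain in $L_I$. A slice domain $\Omega$ is an angular domain if for every $I\in\mathbb{S}$, $\Omega_I=\{re^{I(\zeta_I+\vartheta)}: r>0,\ |\vartheta|<\varphi_I/2\}$ for some $\zeta_I\in\mathbb{R}$, $0<\varphi_I<2\pi$;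 its opening is $\sup_{I\in\mathbb{S}}\varphi_I$. For $f$ slice regular on $\Omega$ and continuous up to the boundary, $M_f(r,\Omega)=\max\{|f(q)|: q\in\overline\Omega,\ |q|=r\}$; the order of $f$ is $\rho=\limsup_{r\to+\infty}\frac{\ln^+\ln^+M_f(r,\Omega)}{\ln r}$ and its type is $\sigma=\limsup_{r\to+\infty}\frac{\ln^+M_f(r,\Omega)}{r^\rho}$, where $\ln^+x=\max\{\ln x,0\}$. *)

theory Defs
  imports "HOL-Analysis.Analysis" "HOL-Library.Liminf_Limsup"
begin

text \<open>Quaternions are modelled as the Euclidean space real^4 (components 1,2,3,4 are
  the coefficients of 1, i, j, k), so the norm is the Euclidean norm |q|.
  The Hamilton product is defined explicitly.\<close>

type_synonym quat = "real ^ 4"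

definition qmult :: "quat \<Rightarrow> quat \<Rightarrow> quat" where
  "qmult p q = vector
     [ p$1 * q$1 - p$2 * q$2 - p$3 * q$3 - p$4 * q$4,
       p$1 * q$2 + p$2 * q$1 + p$3 * q$4 - p$4 * q$3,
       p$1 * q$3 - p$2 * q$4 + p$3 * q$1 + p$4 * q$2,
       p$1 * q$4 + p$2 * q$3 - p$3 * q$2 + p$4 * q$1 ]"

definition qreal :: "real \<Rightarrow> quat" where
  "qreal x = vector [x, 0, 0, 0]"

definition imag_units :: "quat set" where
  "imag_units = {q. q$1 = 0 \<and> (q$2)^2 + (q$3)^2 + (q$4)^2 = 1}"

definition slice_plane :: "quat \<Rightarrow> quat set" where
  "slice_plane I = {qreal x + y *\<^sub>R I | x y. True}"

definition qexpI :: "quat \<Rightarrow> real \<Rightarrow> quat" where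
  "qexpI I t = qreal (cos t) + sin t *\<^sub>R I"

definition slice_regular :: "(quat \<Rightarrow> quat) \<Rightarrow> quat set \<Rightarrow> bool" where
  "slice_regular f \<Omega> \<longleftrightarrow> open \<Omega> \<and>
     (\<forall>I\<in>imag_units. \<forall>x y. qreal x + y *\<^sub>R I \<in> \<Omega> \<longrightarrow>
        (\<exists>Dx Dy. ((\<lambda>t. f (qreal (x + t) + y *\<^sub>R I)) has_vector_derivative Dx) (at 0) \<and>
                 ((\<lambda>t. f (qreal x + (y + t) *\<^sub>R I)) has_vector_derivative Dy) (at 0) \<and>
                 (1/2) *\<^sub>R (Dx + qmult I Dy) = 0))"

definition slice_domain :: "quat set \<Rightarrow> bool" where
  "slice_domain \<Omega> \<longleftrightarrow> open \<Omega> \<and> connected \<Omega> \<and> \<Omega> \<noteq> {} \<and> (\<exists>x. qreal x \<in> \<Omega>) \<and>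
     (\<forall>I\<in>imag_units. connected (\<Omega> \<inter> slice_plane I))"

definition sector :: "quat \<Rightarrow> real \<Rightarrow> real \<Rightarrow> quat set" where
  "sector I \<zeta> \<phi> = {r *\<^sub>R qexpI I (\<zeta> + \<theta>) | r \<theta>. r > 0 \<and> \<bar>\<theta>\<bar> < \<phi> / 2}"

definition angular_domain :: "quat set \<Rightarrow> bool" where
  "angular_domain \<Omega> \<longleftrightarrow> slice_domain \<Omega> \<and>
     (\<forall>I\<in>imag_units. \<exists>\<zeta> \<phi>. 0 < \<phi> \<and> \<phi> < 2 * pi \<and> \<Omega> \<inter> slice_plane I = sector I \<zeta> \<phi>)"

text \<open>\<open>ln\<^sup>+ x = max (ln x) 0\<close>, with the convention \<open>ln\<^sup>+ x = 0\<close> for \<open>x \<le> 1\<close> (incl. x = 0).\<close>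
definition lnp :: "real \<Rightarrow> real" where
  "lnp x = (if x \<le> 1 then 0 else ln x)"

definition max_modulus :: "(quat \<Rightarrow> quat) \<Rightarrow> quat set \<Rightarrow> real \<Rightarrow> real" where
  "max_modulus f \<Omega> r = Sup ((\<lambda>q. norm (f q)) ` {q \<in> closure \<Omega>. norm q = r})"

definition order_of :: "(quat \<Rightarrow> quat) \<Rightarrow> quat set \<Rightarrow> ereal" where
  "order_of f \<Omega> = Limsup at_top (\<lambda>r. ereal (lnp (lnp (max_modulus f \<Omega> r)) / ln r))"

definition type_of :: "(quat \<Rightarrow> quat) \<Rightarrow> quat set \<Rightarrow> real \<Rightarrow> ereal" where
  "type_of f \<Omega> \<rho> = Limsup at_top (\<lambda>r. ereal (lnp (max_modulus f \<Omega> r) / r powr \<rho>))"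

end

theory Submission
  imports Defs "HOL-Complex_Analysis.Complex_Analysis"
begin

text \<open>On the slice of \<open>I\<close>, left multiplication by \<open>I\<close> makes the quaternions a complex vector space, and
  composing \<open>f\<close> with a complex linear functional of norm one that attains the norm of \<open>f\<close> at the point
  under consideration reduces the claim to a scalar function. Slice regularity only provides partial
  derivatives satisfying the Cauchy-Riemann equations, so holomorphy of that scalar function is the
  Looman-Menchoff theorem.

  In the coordinate \<open>w = log z\<close> the sector becomes a strip. After multiplication by
  \<open>exp (- (\<sigma> + \<epsilon>) z\<^sup>\<rho>)\<close> the function is bounded on the bisector and on the edges, hence by
  Phragmen-Lindelof on each of the two half sectors, whose opening is at most \<open>pi / (2 \<rho>)\<close>. A second
  application of Phragmen-Lindelof, to this bounded function on the whole sector, improves the bound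
  to \<open>M\<close>, and \<open>\<epsilon>\<close> tends to \<open>0\<close>.\<close>

section \<open>Increments of functions that are Lipschitz from a closed set\<close>

text \<open>The partial derivatives need not be continuous or even locally bounded, so Green's
  theorem cannot be applied to them directly. Baire's theorem supplies a piece of the bad set from
  which \<open>f\<close> is Lipschitz along both axes. There the derivatives are bounded and
  measurable, and Green's identity holds up to a multiple of the area off the bad set. Since
  \<open>f\<close> is holomorphic off that set, bisection removes this error, and Morera's theorem
  shows that the piece was not bad after all.

  Opening \<open>pi / \<rho>\<close> is critical for growth of order \<rho>:
  \<open>exp (z\<^sup>\<rho>)\<close> has modulus 1 on the edges of such a sector and is unbounded
  inside. Halving the sector gains room, but the resulting bound depends on \<epsilon>; the second
  application of Phragmen-Lindelof removes this dependence. In the coordinate \<open>w\<close> the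
  power is the entire function \<open>exp (\<rho> * w)\<close>, so no branch has to be chosen. The
  linear functional depends on the point where the bound is claimed, so the scalar argument is run
  for each point separately.\<close>

lemma lipschitz_extension_real:
  fixes g :: "real \<Rightarrow> real"
  assumes "K \<noteq> {}" and lip: "\<And>x y. x \<in> K \<Longrightarrow> y \<in> K \<Longrightarrow> \<bar>g x - g y\<bar> \<le> N * \<bar>x - y\<bar>"
    and "N \<ge> 0"
  obtains G where "\<And>x. x \<in> K \<Longrightarrow> G x = g x" "\<And>x y. \<bar>G x - G y\<bar> \<le> N * \<bar>x - y\<bar>"
proof
  \<comment> \<open>McShane's extension: the infimum of the cones of slope \<open>N\<close> with
    apex on the graph of \<open>g\<close> over \<open>K\<close>.\<close>
  define G where "G x = (INF k\<in>K. g k + N * \<bar>x - k\<bar>)" for x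
  obtain k0 where k0: "k0 \<in> K" using assms by auto
  have bdd: "bdd_below ((\<lambda>k. g k + N * \<bar>x - k\<bar>) ` K)" for x
  proof (rule bdd_belowI2)
    fix k assume "k \<in> K"
    have "\<bar>g k0 - g k\<bar> \<le> N * \<bar>k0 - k\<bar>" using lip k0 \<open>k \<in> K\<close> by blast
    also have "\<dots> \<le> N * (\<bar>x - k0\<bar> + \<bar>x - k\<bar>)" using \<open>N \<ge> 0\<close> by (intro mult_left_mono) auto
    finally show "g k0 - N * \<bar>x - k0\<bar> \<le> g k + N * \<bar>x - k\<bar>" by (simp add: distrib_left)
  qed
  show "G x = g x" if "x \<in> K" for x
  proof (rule antisym)
    show "G x \<le> g x" unfolding G_def using cINF_lower[OF bdd that, of x] by simp
    show "g x \<le> G x" unfolding G_def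
      using lip[OF that] by (intro cINF_greatest[OF \<open>K \<noteq> {}\<close>]) (smt (verit))
  qed
  have *: "G x \<le> G y + N * \<bar>x - y\<bar>" for x y
  proof -
    have "G x - N * \<bar>x - y\<bar> \<le> G y"
      unfolding G_def[of y]
    proof (rule cINF_greatest[OF \<open>K \<noteq> {}\<close>])
      fix k assume "k \<in> K"
      have "G x \<le> g k + N * \<bar>x - k\<bar>" unfolding G_def by (rule cINF_lower[OF bdd \<open>k \<in> K\<close>])
      also have "N * \<bar>x - k\<bar> \<le> N * (\<bar>x - y\<bar> + \<bar>y - k\<bar>)" using \<open>N \<ge> 0\<close> by (intro mult_left_mono) auto
      finally show "G x - N * \<bar>x - y\<bar> \<le> g k + N * \<bar>y - k\<bar>" by (simp add: distrib_left)
    qed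
    then show ?thesis by simp
  qed
  show "\<bar>G x - G y\<bar> \<le> N * \<bar>x - y\<bar>" for x y
    using *[of x y] *[of y x] by (simp add: abs_minus_commute)
qed

text \<open>Nothing is assumed about \<open>g\<close> between points outside \<open>K\<close>, so \<open>g\<close> is replaced by a Lipschitz
  extension \<open>G\<close> of its restriction to \<open>K\<close>. On an interval of a fine division with tag in \<open>K\<close>, the
  derivative controls \<open>G\<close> between the extreme points of \<open>K\<close>, and the rest of the interval misses \<open>K\<close>.\<close>

lemma increment_minus_integral_le_real:
  fixes g g' :: "real \<Rightarrow> real"
  assumes "a \<le> b" and K: "closed K" "K \<subseteq> {a..b}" "K \<noteq> {}" and "N \<ge> 0"
    and lip: "\<And>k x. k \<in> K \<Longrightarrow> x \<in> {a..b} \<Longrightarrow> \<bar>g x - g k\<bar> \<le> N * \<bar>x - k\<bar>"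
    and deriv: "\<And>k. k \<in> K \<Longrightarrow> (g has_real_derivative g' k) (at k)"
    and bound: "\<And>k. k \<in> K \<Longrightarrow> \<bar>g' k\<bar> \<le> N"
    and int: "((\<lambda>x. indicator K x * g' x) has_integral J) {a..b}"
  shows "\<bar>g b - g a - J\<bar> \<le> 2 * N * measure lborel ({a..b} - K)"
proof -
  obtain k0 where k0: "k0 \<in> K" using K by auto
  have k0ab: "a \<le> k0" "k0 \<le> b" using k0 K by auto
  \<comment> \<open>The endpoints join \<open>K\<close> so that \<open>G\<close> agrees with
    \<open>g\<close> there. Only the pair \<open>a\<close>, \<open>b\<close> is not covered by
    \<open>lip\<close>; the detour over \<open>k0\<close> costs nothing since \<open>k0\<close> lies
    between them.\<close>
  have lip': "\<bar>g x - g y\<bar> \<le> N * \<bar>x - y\<bar>" if "x \<in> insert a (insert b K)" "y \<in> insert a (insert b K)" for x y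
  proof -
    have "\<bar>g a - g b\<bar> \<le> N * \<bar>a - b\<bar>"
    proof -
      have "\<bar>g a - g b\<bar> \<le> N * \<bar>a - k0\<bar> + N * \<bar>b - k0\<bar>"
        using lip[OF k0, of a] lip[OF k0, of b] \<open>a \<le> b\<close> by auto
      also have "\<dots> = N * \<bar>a - b\<bar>" using k0ab by (simp add: algebra_simps)
      finally show ?thesis .
    qed
    moreover have "\<bar>g x - g y\<bar> \<le> N * \<bar>x - y\<bar>" if "x \<in> K \<or> y \<in> K"
      using that lip[of x y] lip[of y x] \<open>x \<in> insert a (insert b K)\<close> \<open>y \<in> insert a (insert b K)\<close> \<open>a \<le> b\<close> K
      by (auto simp: abs_minus_commute)
    ultimately show ?thesis using that by (auto simp: abs_minus_commute)
  qed
  obtain G where G: "\<And>x. x \<in> insert a (insert b K) \<Longrightarrow> G x = g x"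
    and Glip: "\<And>x y. \<bar>G x - G y\<bar> \<le> N * \<bar>x - y\<bar>"
    using lipschitz_extension_real[of "insert a (insert b K)" g N] lip' \<open>N \<ge> 0\<close> by blast
  \<comment> \<open>Distribution function of the complement of \<open>K\<close>: the errors on the
    intervals of a tagged division become increments of \<open>D\<close> and telescope.\<close>
  define D where "D x = measure lborel ({a..x} - K)" for x
  have Kb: "K \<in> sets borel" using K by auto
  have fm: "{u<..v} - K \<in> fmeasurable lborel" "{u..v} - K \<in> fmeasurable lborel" for u v
  proof -
    have *: "cbox u v \<in> fmeasurable lborel" by (rule fmeasurable_cbox)
    show "{u<..v} - K \<in> fmeasurable lborel"
      by (rule fmeasurableI2[OF *]) (use Kb in auto)
    show "{u..v} - K \<in> fmeasurable lborel"
      by (rule fmeasurableI2[OF *]) (use Kb in auto)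
  qed
  have D: "D v - D u = measure lborel ({u<..v} - K)" if "a \<le> u" "u \<le> v" for u v
  proof -
    have "{a..v} - K = ({a..u} - K) \<union> ({u<..v} - K)" using that by auto
    moreover have "measure lborel (({a..u} - K) \<union> ({u<..v} - K)) = 
        measure lborel ({a..u} - K) + measure lborel ({u<..v} - K)"
      using fm by (intro measure_Un_AE) auto
    ultimately have "D v = D u + measure lborel ({u<..v} - K)"
      unfolding D_def by simp
    then show ?thesis by simp
  qed
  have "\<bar>g b - g a - J\<bar> \<le> 2 * N * measure lborel ({a..b} - K) + e" if "e > 0" for e
  proof -
    \<comment> \<open>The summand 1 keeps the denominator positive when
      \<open>a = b\<close>.\<close>
    define \<epsilon> where "\<epsilon> = e / (2 * (b - a + 1))"
    have eps: "\<epsilon> > 0" using \<open>e > 0\<close> \<open>a \<le> b\<close> by (auto simp: \<epsilon>_def)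
    have eps2: "\<epsilon> * (b - a) \<le> e / 2" using \<open>e > 0\<close> \<open>a \<le> b\<close> by (auto simp: \<epsilon>_def field_simps)
    obtain \<gamma> where \<gamma>: "gauge \<gamma>" and \<gamma>int: "\<And>p. p tagged_division_of {a..b} \<Longrightarrow> \<gamma> fine p \<Longrightarrow>
        norm ((\<Sum>(x, k)\<in>p. measure lborel k *\<^sub>R (indicator K x * g' x)) - J) < e / 2"
      using int[unfolded has_integral[of _ J a b, simplified cbox_interval]] \<open>e > 0\<close>
      by (meson half_gt_zero)
    have "\<exists>d>0. (x \<in> K \<longrightarrow> (\<forall>y. \<bar>y - x\<bar> < d \<longrightarrow> \<bar>g y - g x - g' x * (y - x)\<bar> \<le> \<epsilon> * \<bar>y - x\<bar>))
            \<and> (x \<notin> K \<longrightarrow> ball x d \<inter> K = {})" for x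
    proof (cases "x \<in> K")
      case True
      then show ?thesis
        using deriv[OF True] eps unfolding has_field_derivative_def has_derivative_at_alt
        by (metis real_norm_def)
    next
      case False
      then obtain d where "d > 0" "ball x d \<subseteq> - K"
        using K(1) by (metis ComplI open_Compl open_contains_ball)
      then show ?thesis using False by blast
    qed
    then obtain d where d: "\<And>x. d x > 0"
      and dK: "\<And>x y. x \<in> K \<Longrightarrow> \<bar>y - x\<bar> < d x \<Longrightarrow> \<bar>g y - g x - g' x * (y - x)\<bar> \<le> \<epsilon> * \<bar>y - x\<bar>"
      and dn: "\<And>x. x \<notin> K \<Longrightarrow> ball x (d x) \<inter> K = {}" by metis
    have "gauge (\<lambda>x. ball x (d x))" using d by (auto simp: gauge_def)
    from gauge_Int[OF this \<gamma>] obtain p where p: "p tagged_division_of {a..b}"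
      and pf: "(\<lambda>x. ball x (d x) \<inter> \<gamma> x) fine p" using fine_division_exists_real by blast
    have pf1: "(\<lambda>x. ball x (d x)) fine p" and pf2: "\<gamma> fine p" using pf unfolding fine_def by auto
    have key: "\<bar>G (Sup T) - G (Inf T) - measure lborel T * (indicator K x * g' x)\<bar>
        \<le> \<epsilon> * (Sup T - Inf T) + 2 * N * (D (Sup T) - D (Inf T))" if xT: "(x, T) \<in> p" for x T
    proof -
      obtain u v where T: "T = {u..v}" using tagged_division_ofD(4)[OF p xT] by auto
      have x: "u \<le> x" "x \<le> v" using tagged_division_ofD(2)[OF p xT] T by auto
      have uv: "a \<le> u" "v \<le> b" using tagged_division_ofD(3)[OF p xT] T x by auto
      have Tb: "{u..v} \<subseteq> ball x (d x)" using pf1 xT T unfolding fine_def by auto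
      have Duv: "D v - D u = measure lborel ({u<..v} - K)" using D uv x by auto
      have "\<bar>G v - G u - (v - u) * (indicator K x * g' x)\<bar> \<le> \<epsilon> * (v - u) + 2 * N * (D v - D u)"
      proof (cases "x \<in> K")
        case False
        then have "{u..v} \<inter> K = {}" using dn[OF False] Tb by blast
        then have "{u<..v} - K = {u<..v}" by (auto simp: disjoint_iff)
        then have "D v - D u = v - u" using Duv x by simp
        moreover have "\<bar>G v - G u\<bar> \<le> N * (v - u)" using Glip[of v u] x by simp
        moreover have "0 \<le> \<epsilon> * (v - u)" "0 \<le> N * (v - u)" using eps x \<open>N \<ge> 0\<close> by auto
        ultimately show ?thesis using False by simp
      next
        case True
        have comp: "compact (K \<inter> {u..v})" and ne: "K \<inter> {u..v} \<noteq> {}"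
          using K True x by (auto simp: closed_Int_compact)
        obtain v' where v': "v' \<in> K" "u \<le> v'" "v' \<le> v" "\<And>t. t \<in> K \<Longrightarrow> u \<le> t \<Longrightarrow> t \<le> v \<Longrightarrow> t \<le> v'"
          using compact_attains_sup[OF comp ne] by auto
        obtain u' where u': "u' \<in> K" "u \<le> u'" "u' \<le> v" "\<And>t. t \<in> K \<Longrightarrow> u \<le> t \<Longrightarrow> t \<le> v \<Longrightarrow> u' \<le> t"
          using compact_attains_inf[OF comp ne] by auto
        have xx: "u' \<le> x" "x \<le> v'" using u' v' True x by auto
        \<comment> \<open>The two end pieces miss \<open>K\<close>, so their total length is charged
          to the increment of \<open>D\<close>.\<close>
        have "measure lborel ({u<..<u'} \<union> {v'<..v}) \<le> measure lborel ({u<..v} - K)"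
        proof (rule measure_mono_fmeasurable)
          show "{u<..<u'} \<union> {v'<..v} \<subseteq> {u<..v} - K"
            using u' v' xx by fastforce
        qed (use fm in auto)
        moreover have "measure lborel ({u<..<u'} \<union> {v'<..v}) = (u' - u) + (v - v')"
          using u' v' xx by (subst measure_Union) auto
        ultimately have Dge: "(u' - u) + (v - v') \<le> D v - D u" using Duv by simp
        have "\<bar>v' - x\<bar> < d x" "\<bar>u' - x\<bar> < d x" 
          using Tb u' v' by (auto simp: subset_eq dist_real_def abs_minus_commute)
        then have 1: "\<bar>G v' - G x - g' x * (v' - x)\<bar> \<le> \<epsilon> * (v' - x)"
          and 2: "\<bar>G u' - G x - g' x * (u' - x)\<bar> \<le> \<epsilon> * (x - u')"
          using dK[OF True, of v'] dK[OF True, of u'] G u' v' True xx by auto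
        have 3: "\<bar>G v - G v'\<bar> \<le> N * (v - v')" "\<bar>G u - G u'\<bar> \<le> N * (u' - u)"
          using Glip[of v v'] Glip[of u u'] u' v' by auto
        \<comment> \<open>The end pieces enter twice, through the slope of \<open>G\<close> and
          through the term \<open>g' x\<close> of the Riemann sum; hence the factor
          \<open>2 * N\<close>.\<close>
        have 4: "\<bar>g' x * (v - v')\<bar> \<le> N * (v - v')" "\<bar>g' x * (u' - u)\<bar> \<le> N * (u' - u)"
          using bound[OF True] u' v' by (auto simp: abs_mult intro!: mult_right_mono)
        have eq: "G v - G u - (v - u) * g' x = (G v - G v') - (G u - G u') + (G v' - G x - g' x * (v' - x))
            - (G u' - G x - g' x * (u' - x)) - g' x * (v - v') - g' x * (u' - u)"
          by (simp add: algebra_simps)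
        have tri: "\<bar>p - q + r - s - t - w\<bar> \<le> \<bar>p\<bar> + \<bar>q\<bar> + \<bar>r\<bar> + \<bar>s\<bar> + \<bar>t\<bar> + \<bar>w\<bar>" for p q r s t w :: real
          by linarith
        have "\<bar>G v - G u - (v - u) * g' x\<bar> \<le> N * (v - v') + N * (u' - u) + \<epsilon> * (v' - x) + \<epsilon> * (x - u')
            + N * (v - v') + N * (u' - u)"
          unfolding eq by (intro order_trans[OF tri] add_mono 1 2 3 4)
        also have "\<dots> = \<epsilon> * (v' - u') + 2 * N * ((u' - u) + (v - v'))" by (simp add: algebra_simps)
        also have "\<dots> \<le> \<epsilon> * (v - u) + 2 * N * (D v - D u)"
          using Dge \<open>N \<ge> 0\<close> eps u' v' by (intro add_mono mult_left_mono) auto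
        finally show ?thesis using True by simp
      qed
      then show ?thesis using T x by simp
    qed
    have "\<bar>(\<Sum>(x,T)\<in>p. G (Sup T) - G (Inf T)) - (\<Sum>(x, T)\<in>p. measure lborel T * (indicator K x * g' x))\<bar>
        \<le> (\<Sum>(x,T)\<in>p. \<epsilon> * (Sup T - Inf T) + 2 * N * (D (Sup T) - D (Inf T)))"
      unfolding sum_subtractf[symmetric]
      using key by (intro sum_abs[THEN order_trans] sum_mono) auto
    also have "\<dots> = \<epsilon> * (b - a) + 2 * N * (D b - D a)"
      using additive_tagged_division_1[OF \<open>a \<le> b\<close> p, of "\<lambda>x. \<epsilon> * x + 2 * N * D x"]
      by (simp add: algebra_simps)
    finally have "\<bar>(G b - G a) - (\<Sum>(x, T)\<in>p. measure lborel T * (indicator K x * g' x))\<bar> \<le> \<epsilon> * (b - a) + 2 * N * (D b - D a)"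
      using additive_tagged_division_1[OF \<open>a \<le> b\<close> p, of G] by simp
    moreover have "\<bar>(\<Sum>(x, T)\<in>p. measure lborel T * (indicator K x * g' x)) - J\<bar> < e / 2"
      using \<gamma>int[OF p pf2] by simp
    moreover have "G b = g b" "G a = g a" using G by auto
    moreover have "2 * N * (D b - D a) \<le> 2 * N * measure lborel ({a..b} - K)"
      using \<open>N \<ge> 0\<close> by (intro mult_left_mono) (auto simp: D_def)
    ultimately show ?thesis using eps2 by linarith
  qed
  then show ?thesis by (rule field_le_epsilon)
qed

text \<open>Real and imaginary parts satisfy the hypotheses of the real estimate with the same
  \<open>N\<close>; adding the two bounds doubles the constant.\<close>

lemma increment_minus_integral_le_complex:
  fixes g g' :: "real \<Rightarrow> complex"
  assumes "a \<le> b" and K: "closed K" "K \<subseteq> {a..b}" "K \<noteq> {}" and "N \<ge> 0"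
    and lip: "\<And>k x. k \<in> K \<Longrightarrow> x \<in> {a..b} \<Longrightarrow> norm (g x - g k) \<le> N * \<bar>x - k\<bar>"
    and deriv: "\<And>k. k \<in> K \<Longrightarrow> (g has_vector_derivative g' k) (at k)"
    and bound: "\<And>k. k \<in> K \<Longrightarrow> norm (g' k) \<le> N"
    and int: "((\<lambda>x. indicator K x *\<^sub>R g' x) has_integral J) {a..b}"
  shows "norm (g b - g a - J) \<le> 4 * N * measure lborel ({a..b} - K)"
proof -
  have part: "\<bar>L (g b) - L (g a) - L J\<bar> \<le> 2 * N * measure lborel ({a..b} - K)"
    if L: "bounded_linear L" and nL: "\<And>z. \<bar>L z\<bar> \<le> norm z" for L :: "complex \<Rightarrow> real"
  proof (rule increment_minus_integral_le_real[where g' = "\<lambda>x. L (g' x)"])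
    interpret L: bounded_linear L by (fact L)
    show "\<bar>L (g x) - L (g k)\<bar> \<le> N * \<bar>x - k\<bar>" if "k \<in> K" "x \<in> {a..b}" for k x
      using nL[of "g x - g k"] lip[OF that] by (simp add: L.diff)
    show "((\<lambda>x. L (g x)) has_real_derivative L (g' k)) (at k)" if "k \<in> K" for k
      using L.has_vector_derivative[OF deriv[OF that]]
      by (simp add: has_real_derivative_iff_has_vector_derivative)
    show "\<bar>L (g' k)\<bar> \<le> N" if "k \<in> K" for k
      using nL[of "g' k"] bound[OF that] by simp
    show "((\<lambda>x. indicator K x * L (g' x)) has_integral L J) {a..b}"
      using has_integral_linear[OF int L] by (simp add: o_def L.scaleR)
  qed (use assms in auto)
  have "norm (g b - g a - J) \<le> \<bar>Re (g b - g a - J)\<bar> + \<bar>Im (g b - g a - J)\<bar>"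
    by (rule cmod_le)
  also have "\<dots> \<le> 2 * (2 * N * measure lborel ({a..b} - K))"
    using part[OF bounded_linear_Re abs_Re_le_cmod] part[OF bounded_linear_Im abs_Im_le_cmod] by simp
  finally show ?thesis by simp
qed

text \<open>Fubini over vertical lines. A line meeting \<open>E\<close> is handled by the
  one-dimensional estimate. On a line missing \<open>E\<close> the increment is compared with values
  at the points of \<open>E\<close> on the bottom and top sides; this costs a multiple of
  \<open>N * (d - c)\<close>, and the whole segment of length \<open>d - c\<close> counts as area
  off \<open>E\<close>. The constant \<kappa> bounds horizontal distances by vertical ones.\<close>

lemma vertical_increment_minus_integral_le:
  fixes F Fy :: "real \<times> real \<Rightarrow> complex"
  assumes E: "compact E" "E \<subseteq> {a'..b'} \<times> {c'..d'}"
    and sub: "a \<le> a'" "b' \<le> b" "c \<le> c'" "d' \<le> d" and le: "a' \<le> b'" "c' \<le> d'"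
    and touch: "(x1, c') \<in> E" "(x2, d') \<in> E" and "N \<ge> 0"
    and lipx: "\<And>x y x'. (x, y) \<in> E \<Longrightarrow> x' \<in> {a..b} \<Longrightarrow> norm (F (x', y) - F (x, y)) \<le> N * \<bar>x' - x\<bar>"
    and lipy: "\<And>x y y'. (x, y) \<in> E \<Longrightarrow> y' \<in> {c..d} \<Longrightarrow> norm (F (x, y') - F (x, y)) \<le> N * \<bar>y' - y\<bar>"
    and deriv: "\<And>x y. (x, y) \<in> E \<Longrightarrow> ((\<lambda>t. F (x, t)) has_vector_derivative Fy (x, y)) (at y)"
    and bound: "\<And>p. p \<in> E \<Longrightarrow> norm (Fy p) \<le> N"
    and cont: "continuous_on ({a..b} \<times> {c..d}) F"
    and meas: "(\<lambda>p. indicator E p *\<^sub>R Fy p) \<in> borel_measurable borel"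
    and aspect: "b - a \<le> \<kappa> * (d - c)"
  shows "norm (integral {a'..b'} (\<lambda>x. F (x, d') - F (x, c')) - (\<integral>p. indicator E p *\<^sub>R Fy p \<partial>lborel))
    \<le> (3 * \<kappa> + 4) * N * measure lborel ({a..b} \<times> {c..d} - E)"
proof -
  define C where "C = (3 * \<kappa> + 4) * N"
  define K where "K x = {y. (x, y) \<in> E}" for x
  define h where "h x = (\<integral>y. indicator E (x, y) *\<^sub>R Fy (x, y) \<partial>lborel)" for x
  define Q where "Q = {a..b} \<times> {c..d}"
  have Eb: "E \<in> sets borel" using compact_imp_closed[OF E(1)] by simp
  have EQ: "E \<subseteq> Q" using E(2) sub by (force simp: Q_def)
  have abcd: "a \<le> b" "c \<le> d" using sub le by auto
  have "closed ((\<lambda>y. (x, y)) -` E)" for x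
    using E(1) by (intro closed_vimage compact_imp_closed continuous_intros)
  then have Kc: "closed (K x)" for x by (simp add: K_def vimage_def)
  have Ksub: "K x \<subseteq> {c'..d'}" for x using E(2) by (auto simp: K_def)
  have indK: "indicator E (x, y) = (indicator (K x) y :: real)" for x y
    by (auto simp: indicator_def K_def)
  have msec: "(\<lambda>y. indicator (K x) y *\<^sub>R Fy (x, y)) \<in> borel_measurable borel" for x
  proof -
    have "(\<lambda>y. (\<lambda>p. indicator E p *\<^sub>R Fy p) (x, y)) \<in> borel_measurable borel"
      by (rule measurable_compose[OF _ meas]) simp
    then show ?thesis by (simp add: indK)
  qed
  have isec: "integrable lborel (\<lambda>y. indicator (K x) y *\<^sub>R Fy (x, y))" for x
  proof (rule integrableI_bounded_set[where A="{c'..d'}" and B=N])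
    show "(\<lambda>y. indicator (K x) y *\<^sub>R Fy (x, y)) \<in> borel_measurable lborel" using msec by simp
    show "AE y\<in>{c'..d'} in lborel. norm (indicator (K x) y *\<^sub>R Fy (x, y)) \<le> N"
      using bound \<open>N \<ge> 0\<close> by (intro AE_I2) (auto simp: indicator_def K_def)
    show "AE y in lborel. y \<notin> {c'..d'} \<longrightarrow> indicator (K x) y *\<^sub>R Fy (x, y) = 0"
      using Ksub[of x] by (intro AE_I2) (auto simp: indicator_def)
  qed (auto simp: emeasure_lborel_Icc_eq)
  have hsec: "((\<lambda>y. indicator (K x) y *\<^sub>R Fy (x, y)) has_integral h x) {c'..d'}" for x
  proof -
    have "((\<lambda>y. indicator (K x) y *\<^sub>R Fy (x, y)) has_integral h x) UNIV"
      using has_integral_integral_lborel[OF isec[of x]] by (simp add: h_def indK)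
    moreover have "indicator (K x) y *\<^sub>R Fy (x, y) = 
        (if y \<in> {c'..d'} then indicator (K x) y *\<^sub>R Fy (x, y) else 0)" for y
      using Ksub[of x] by (auto simp: indicator_def)
    ultimately show ?thesis
      using has_integral_restrict_UNIV[of "{c'..d'}" "\<lambda>y. indicator (K x) y *\<^sub>R Fy (x, y)" "h x"] by simp
  qed
  \<comment> \<open>\<open>aspect\<close> forces \<kappa> \<ge> 0 only when \<open>c < d\<close>;
    the degenerate case is split off in \<open>key\<close>.\<close>
  have C: "C \<ge> 4 * N" "C \<ge> 0" if "d - c > 0"
  proof -
    have "0 \<le> \<kappa> * (d - c)" using aspect abcd by linarith
    then have "\<kappa> \<ge> 0" using that by (simp add: zero_le_mult_iff)
    then show "C \<ge> 4 * N" "C \<ge> 0" using \<open>N \<ge> 0\<close> by (auto simp: C_def algebra_simps)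
  qed
  have key: "norm (F (x, d') - F (x, c') - h x) \<le> C * measure lborel ({c..d} - K x)"
    if x: "x \<in> {a'..b'}" for x
  proof (cases "c = d")
    case True
    then have cd: "c' = d'" using sub le by auto
    have "((\<lambda>y. indicator (K x) y *\<^sub>R Fy (x, y)) has_integral 0) {c'..d'}"
      using cd by (simp add: has_integral_refl)
    then have "h x = 0" using hsec[of x] has_integral_unique by blast
    moreover have "measure lborel ({c..d} - K x) = 0"
    proof -
      have "{c..d} - K x \<in> sets lborel" using borel_closed[OF Kc[of x]] by simp
      then have "measure lborel ({c..d} - K x) \<le> measure lborel {c..d}"
        using fmeasurable_cbox[of c d] by (intro measure_mono_fmeasurable) auto
      then show ?thesis using True by (simp add: order_antisym)
    qed
    ultimately show ?thesis using cd by simp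
  next
    case False
    then have cd: "c < d" using abcd by simp
    show ?thesis
    proof (cases "K x = {}")
      case True
      have "h x = 0" using True by (simp add: h_def indK)
      have xab: "x \<in> {a..b}" "x1 \<in> {a..b}" "x2 \<in> {a..b}"
        using x sub touch E(2) by auto
      \<comment> \<open>Route from \<open>(x, d')\<close> over \<open>(x2, d')\<close>,
        \<open>(x2, c')\<close> and \<open>(x1, c')\<close> to \<open>(x, c')\<close>: each leg has
        an end in \<open>E\<close>. Three horizontal legs and a vertical one give
        \<open>3 * \<kappa> + 1\<close>, which \<open>3 * \<kappa> + 4\<close> covers.\<close>
      have "norm (F (x, c') - F (x1, c')) \<le> N * (b - a)" "norm (F (x, d') - F (x2, d')) \<le> N * (b - a)"
        "norm (F (x2, c') - F (x1, c')) \<le> N * (b - a)"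
        by (rule order_trans[OF lipx mult_left_mono]; use touch xab \<open>N \<ge> 0\<close> in auto)+
      moreover have "norm (F (x2, c') - F (x2, d')) \<le> N * (d - c)"
        by (rule order_trans[OF lipy mult_left_mono]; use touch sub le \<open>N \<ge> 0\<close> in auto)
      moreover have "F (x, d') - F (x, c') = (F (x, d') - F (x2, d')) - (F (x, c') - F (x1, c'))
          - (F (x2, c') - F (x2, d')) + (F (x2, c') - F (x1, c'))" by simp
      moreover have "norm (A - B - C + D) \<le> norm A + norm B + norm C + norm D" for A B C D :: complex
        by norm
      ultimately have "norm (F (x, d') - F (x, c')) \<le> 3 * (N * (b - a)) + N * (d - c)"
        by (smt (verit))
      also have "\<dots> \<le> 3 * (N * (\<kappa> * (d - c))) + N * (d - c)"
        using aspect \<open>N \<ge> 0\<close> by (intro add_mono mult_left_mono) auto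
      also have "\<dots> \<le> C * (d - c)"
        using \<open>N \<ge> 0\<close> cd by (simp add: C_def algebra_simps mult_left_mono)
      finally show ?thesis using True \<open>h x = 0\<close> cd by simp
    next
      case False
      have "norm (F (x, d') - F (x, c') - h x) \<le> 4 * N * measure lborel ({c'..d'} - K x)"
      proof (rule increment_minus_integral_le_complex[where g' = "\<lambda>y. Fy (x, y)"])
        show "norm (F (x, y) - F (x, k)) \<le> N * \<bar>y - k\<bar>" if "k \<in> K x" "y \<in> {c'..d'}" for k y
          using lipy[of x k y] that sub by (auto simp: K_def)
      qed (use hsec Kc Ksub False le \<open>N \<ge> 0\<close> deriv bound in \<open>auto simp: K_def\<close>)
      also have "\<dots> \<le> C * measure lborel ({c..d} - K x)"
      proof (intro mult_mono C)
        show "measure lborel ({c'..d'} - K x) \<le> measure lborel ({c..d} - K x)"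
        proof (rule measure_mono_fmeasurable)
          show "{c..d} - K x \<in> fmeasurable lborel"
            by (rule fmeasurableI2[OF fmeasurable_cbox[of c d]]) (use Kc[of x] in auto)
        qed (use sub Kc[of x] in auto)
      qed (use cd C in auto)
      finally show ?thesis .
    qed
  qed
  \<comment> \<open>Outside \<open>{a'..b'}\<close> both terms of \<open>\<Phi>\<close> vanish, so
    the pointwise bound \<open>key\<close> can be integrated over the whole line.\<close>
  define \<Phi> where "\<Phi> x = indicator {a'..b'} x *\<^sub>R (F (x, d') - F (x, c')) - h x" for x
  define \<Psi> where "\<Psi> x = C * (indicator {a..b} x * measure lborel ({c..d} - K x))" for x
  have Ffin: "emeasure lborel Q < \<infinity>" 
    unfolding Q_def using emeasure_lborel_cbox_finite[of "(a,c)" "(b,d)"] by (simp add: cbox_Pair_eq)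
  have Qb: "Q \<in> sets borel" unfolding Q_def
    by (intro borel_closed closed_Times) auto
  have intE: "integrable (lborel \<Otimes>\<^sub>M lborel) (\<lambda>p. indicator E p *\<^sub>R Fy p)"
    unfolding lborel_prod
  proof (rule integrableI_bounded_set[where A=Q and B=N])
    show "AE y\<in>Q in lborel. norm (indicator E y *\<^sub>R Fy y) \<le> N"
      using bound \<open>N \<ge> 0\<close> by (intro AE_I2) (auto simp: indicator_def)
    show "AE y in lborel. y \<notin> Q \<longrightarrow> indicator E y *\<^sub>R Fy y = 0"
      using EQ by (intro AE_I2) (auto simp: indicator_def)
  qed (use meas Qb Ffin in auto)
  have intQ: "integrable (lborel \<Otimes>\<^sub>M lborel) (indicator (Q - E) :: real \<times> real \<Rightarrow> real)"
  proof -
    have "emeasure lborel (Q - E) \<le> emeasure lborel Q" using Qb by (intro emeasure_mono) auto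
    then show ?thesis unfolding lborel_prod using Qb Eb Ffin
      by (auto simp: integrable_indicator_iff)
  qed
  have inth: "integrable lborel h" unfolding h_def
    by (rule lborel_pair.integrable_fst'[OF intE])
  have hE: "integral\<^sup>L lborel h = (\<integral>p. indicator E p *\<^sub>R Fy p \<partial>lborel)"
    unfolding h_def by (subst lborel_pair.integral_fst'[OF intE]) (simp add: lborel_prod)
  have secQ: "(\<integral>y. indicator (Q - E) (x, y) \<partial>lborel) = indicator {a..b} x * measure lborel ({c..d} - K x)" for x
  proof -
    have "(\<lambda>y. indicator (Q - E) (x, y) :: real) = (\<lambda>y. indicator {a..b} x * indicator ({c..d} - K x) y)"
      by (auto simp: fun_eq_iff indicator_def Q_def K_def)
    then show ?thesis using Kc[of x] by simp
  qed
  have int\<Psi>: "integrable lborel \<Psi>" "integral\<^sup>L lborel \<Psi> = C * measure lborel (Q - E)"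
  proof -
    show "integrable lborel \<Psi>"
      unfolding \<Psi>_def using lborel_pair.integrable_fst'[OF intQ] by (simp add: secQ)
    have "integral\<^sup>L lborel \<Psi> = C * (\<integral>p. indicator (Q - E) p \<partial>(lborel \<Otimes>\<^sub>M lborel))"
      unfolding \<Psi>_def using lborel_pair.integral_fst'[OF intQ] by (simp add: secQ)
    then show "integral\<^sup>L lborel \<Psi> = C * measure lborel (Q - E)"
      using Qb Eb by (simp add: lborel_prod)
  qed
  have cF: "continuous_on {a'..b'} (\<lambda>x. F (x, d') - F (x, c'))"
    by (intro continuous_intros continuous_on_compose2[OF cont]) (use sub le in auto)
  have setI: "set_integrable lborel {a'..b'} (\<lambda>x. F (x, d') - F (x, c'))"
    using cF by (intro borel_integrable_atLeastAtMost') auto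
  have int1: "integrable lborel (\<lambda>x. indicator {a'..b'} x *\<^sub>R (F (x, d') - F (x, c')))"
    using setI by (simp add: set_integrable_def)
  have int2: "(\<integral>x. indicator {a'..b'} x *\<^sub>R (F (x, d') - F (x, c')) \<partial>lborel) = integral {a'..b'} (\<lambda>x. F (x, d') - F (x, c'))"
    using set_borel_integral_eq_integral(2)[OF setI] by (simp add: set_lebesgue_integral_def)
  have int\<Phi>: "integrable lborel \<Phi>" unfolding \<Phi>_def using int1 inth by simp
  have "norm (integral\<^sup>L lborel \<Phi>) \<le> integral\<^sup>L lborel \<Psi>"
  proof (rule Bochner_Integration.integral_norm_bound_integral[OF int\<Phi> int\<Psi>(1)])
    fix x
    show "norm (\<Phi> x) \<le> \<Psi> x"
    proof (cases "x \<in> {a'..b'}")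
      case True
      moreover have "x \<in> {a..b}" using True sub by simp
      ultimately have "\<Phi> x = F (x, d') - F (x, c') - h x" "\<Psi> x = C * measure lborel ({c..d} - K x)"
        unfolding \<Phi>_def \<Psi>_def by (simp_all only: indicator_simps scaleR_one mult_1)
      then show ?thesis using key[OF True] by (simp only:)
    next
      case False
      then have "K x = {}" using E(2) by (auto simp: K_def)
      then have "h x = 0" by (simp add: h_def indK)
      then have "\<Phi> x = 0" using False by (simp add: \<Phi>_def)
      moreover have "0 \<le> C * measure lborel {c..d}" using C abcd by (cases "c = d") auto
      then have "0 \<le> \<Psi> x" using \<open>K x = {}\<close> abcd by (simp add: \<Psi>_def indicator_def)
      ultimately show ?thesis by simp
    qed
  qed
  moreover have "integral\<^sup>L lborel \<Phi> = integral {a'..b'} (\<lambda>x. F (x, d') - F (x, c')) - (\<integral>p. indicator E p *\<^sub>R Fy p \<partial>lborel)"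
    unfolding \<Phi>_def using int1 int2 inth hE by simp
  ultimately show ?thesis by (simp add: int\<Psi>(2) C_def Q_def)
qed

section \<open>Integrals over the boundary of a rectangle\<close>

text \<open>The counterclockwise contour integral over the boundary, as four real integrals; cutting
  a rectangle then amounts to splitting intervals.\<close>

definition rect_integral :: "(complex \<Rightarrow> complex) \<Rightarrow> real \<Rightarrow> real \<Rightarrow> real \<Rightarrow> real \<Rightarrow> complex" where
  "rect_integral f a b c d =
     integral {a..b} (\<lambda>x. f (Complex x c)) - integral {a..b} (\<lambda>x. f (Complex x d))
     + \<i> * (integral {c..d} (\<lambda>y. f (Complex b y)) - integral {c..d} (\<lambda>y. f (Complex a y)))"

abbreviation rect :: "real \<Rightarrow> real \<Rightarrow> real \<Rightarrow> real \<Rightarrow> complex set" where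
  "rect a b c d \<equiv> cbox (Complex a c) (Complex b d)"

lemma continuous_on_horizontal:
  assumes "continuous_on (rect a b c d) f" "c \<le> y" "y \<le> d"
  shows "continuous_on {a..b} (\<lambda>x. f (Complex x y))"
  using assms(2,3) unfolding Complex_eq
  by (intro continuous_on_compose2[OF assms(1)] continuous_intros) (auto simp: in_cbox_complex_iff)

lemma continuous_on_vertical:
  assumes "continuous_on (rect a b c d) f" "a \<le> x" "x \<le> b"
  shows "continuous_on {c..d} (\<lambda>y. f (Complex x y))"
  using assms(2,3) unfolding Complex_eq
  by (intro continuous_on_compose2[OF assms(1)] continuous_intros) (auto simp: in_cbox_complex_iff)

lemma rect_integral_split_Re:
  assumes "continuous_on (rect a b c d) f" "a \<le> m" "m \<le> b" "c \<le> d"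
  shows "rect_integral f a b c d = rect_integral f a m c d + rect_integral f m b c d"
proof -
  have "integral {a..b} (\<lambda>x. f (Complex x y)) = integral {a..m} (\<lambda>x. f (Complex x y)) + integral {m..b} (\<lambda>x. f (Complex x y))"
    if "y \<in> {c, d}" for y
    using Henstock_Kurzweil_Integration.integral_combine[OF assms(2,3) integrable_continuous_real[OF continuous_on_horizontal[OF assms(1)]], of y] that assms by auto
  from this[of c] this[of d] show ?thesis by (simp add: rect_integral_def algebra_simps)
qed

lemma rect_integral_split_Im:
  assumes "continuous_on (rect a b c d) f" "c \<le> m" "m \<le> d" "a \<le> b"
  shows "rect_integral f a b c d = rect_integral f a b c m + rect_integral f a b m d"
proof -
  have "integral {c..d} (\<lambda>y. f (Complex x y)) = integral {c..m} (\<lambda>y. f (Complex x y)) + integral {m..d} (\<lambda>y. f (Complex x y))"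
    if "x \<in> {a, b}" for x
    using Henstock_Kurzweil_Integration.integral_combine[OF assms(2,3) integrable_continuous_real[OF continuous_on_vertical[OF assms(1)]], of x] that assms by auto
  from this[of a] this[of b] show ?thesis by (simp add: rect_integral_def algebra_simps)
qed

text \<open>Continuity on the closed convex rectangle and differentiability inside give a primitive
  up to the boundary. Each edge contributes a difference of corner values, and these cancel.\<close>

lemma rect_integral_eq_0:
  assumes cont: "continuous_on (rect a b c d) f" and "a \<le> b" "c \<le> d"
    and diff: "\<And>z. z \<in> box (Complex a c) (Complex b d) \<Longrightarrow> f field_differentiable at z"
  shows "rect_integral f a b c d = 0"
proof -
  let ?S = "rect a b c d"
  obtain g where g: "\<And>z. z \<in> ?S \<Longrightarrow> (g has_field_derivative f z) (at z within ?S)"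
    using holomorphic_convex_primitive[of ?S "{}" f] cont diff by (auto simp: interior_cbox)
  have hor: "integral {a..b} (\<lambda>x. f (Complex x y)) = g (Complex b y) - g (Complex a y)" if "y \<in> {c..d}" for y
  proof (rule integral_unique, rule fundamental_theorem_of_calculus[OF \<open>a \<le> b\<close>])
    fix x assume x: "x \<in> {a..b}"
    have "((\<lambda>x. Complex x y) has_vector_derivative 1) (at x within {a..b})"
      unfolding Complex_eq by (auto intro!: derivative_eq_intros)
    moreover have "(g has_field_derivative f (Complex x y)) (at (Complex x y) within (\<lambda>x. Complex x y) ` {a..b})"
      by (rule DERIV_subset[OF g]) (use x that in \<open>auto simp: in_cbox_complex_iff\<close>)
    ultimately show "((\<lambda>x. g (Complex x y)) has_vector_derivative f (Complex x y)) (at x within {a..b})"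
      using field_vector_diff_chain_within by (fastforce simp: o_def)
  qed
  have ver: "\<i> * integral {c..d} (\<lambda>y. f (Complex x y)) = g (Complex x d) - g (Complex x c)" if "x \<in> {a..b}" for x
  proof -
    have "((\<lambda>y. \<i> * f (Complex x y)) has_integral (g (Complex x d) - g (Complex x c))) {c..d}"
    proof (rule fundamental_theorem_of_calculus[OF \<open>c \<le> d\<close>])
      fix y assume y: "y \<in> {c..d}"
      have "((\<lambda>y. Complex x y) has_vector_derivative \<i>) (at y within {c..d})"
        unfolding Complex_eq by (auto intro!: derivative_eq_intros)
      moreover have "(g has_field_derivative f (Complex x y)) (at (Complex x y) within (\<lambda>y. Complex x y) ` {c..d})"
        by (rule DERIV_subset[OF g]) (use y that in \<open>auto simp: in_cbox_complex_iff\<close>)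
      ultimately show "((\<lambda>y. g (Complex x y)) has_vector_derivative \<i> * f (Complex x y)) (at y within {c..d})"
        using field_vector_diff_chain_within by (fastforce simp: o_def)
    qed
    from integral_unique[OF this] show ?thesis by simp
  qed
  show ?thesis unfolding rect_integral_def
    using hor[of c] hor[of d] ver[of a] ver[of b] assms(2,3) by (simp add: right_diff_distrib)
qed

text \<open>Goursat's bisection for an arbitrary property that a rectangle inherits from its four
  quarters: if the large rectangle is bad, bad rectangles of the same proportions shrink to a point.
  The product equation states the proportions without division.\<close>

lemma rect_bisection:
  fixes P :: "real \<Rightarrow> real \<Rightarrow> real \<Rightarrow> real \<Rightarrow> bool"
  assumes "a < b" "c < d" and bad: "\<not> P a b c d"
    and step: "\<And>a' b' c' d'. a \<le> a' \<Longrightarrow> a' < b' \<Longrightarrow> b' \<le> b \<Longrightarrow> c \<le> c' \<Longrightarrow> c' < d' \<Longrightarrow> d' \<le> d \<Longrightarrow>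
        P a' ((a' + b') / 2) c' ((c' + d') / 2) \<Longrightarrow> P ((a' + b') / 2) b' c' ((c' + d') / 2) \<Longrightarrow>
        P a' ((a' + b') / 2) ((c' + d') / 2) d' \<Longrightarrow> P ((a' + b') / 2) b' ((c' + d') / 2) d' \<Longrightarrow> P a' b' c' d'"
  obtains x y where "\<And>e. e > 0 \<Longrightarrow> \<exists>a' b' c' d'. a \<le> a' \<and> a' < b' \<and> b' \<le> b \<and> c \<le> c' \<and> c' < d' \<and> d' \<le> d \<and>
      x \<in> {a'..b'} \<and> y \<in> {c'..d'} \<and> b' - a' < e \<and> d' - c' < e \<and>
      (b' - a') * (d - c) = (d' - c') * (b - a) \<and> \<not> P a' b' c' d'"
proof -
  define L where "L n = (b - a) / 2 ^ n" for n :: nat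
  define H where "H n = (d - c) / 2 ^ n" for n :: nat
  have LH: "L n = L (Suc n) + L (Suc n)" "H n = H (Suc n) + H (Suc n)" "L n > 0" "H n > 0" for n
    using assms(1,2) by (auto simp: L_def H_def field_simps)
  \<comment> \<open>Only the lower left corner is chosen; the sides \<open>L n\<close> and
    \<open>H n\<close> depend on the depth alone, which preserves the proportions.\<close>
  define inv where "inv n p \<longleftrightarrow> a \<le> fst p \<and> fst p + L n \<le> b \<and> c \<le> snd p \<and> snd p + H n \<le> d \<and>
      \<not> P (fst p) (fst p + L n) (snd p) (snd p + H n)" for n and p :: "real \<times> real"
  have "\<exists>p. \<forall>n. inv n (p n) \<and> (fst (p (Suc n)) \<in> {fst (p n), fst (p n) + L (Suc n)} \<and>
      snd (p (Suc n)) \<in> {snd (p n), snd (p n) + H (Suc n)})"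
  proof (rule dependent_nat_choice)
    show "\<exists>p. inv 0 p" using bad by (intro exI[of _ "(a, c)"]) (auto simp: inv_def L_def H_def)
  next
    fix p n assume I: "inv n p"
    obtain u v where p: "p = (u, v)" by (cases p)
    define h k where "h = L (Suc n)" and "k = H (Suc n)"
    have Ln: "L n = h + h" "H n = k + k" and hk: "h > 0" "k > 0"
      using LH(1,2)[of n] LH(3,4)[of "Suc n"] by (auto simp: h_def k_def)
    have "\<exists>u'\<in>{u, u + h}. \<exists>v'\<in>{v, v + k}. \<not> P u' (u' + h) v' (v' + k)"
    proof (rule ccontr)
      assume "\<not> ?thesis"
      then have *: "P u (u + h) v (v + k)" "P (u + h) (u + h + h) v (v + k)"
        "P u (u + h) (v + k) (v + k + k)" "P (u + h) (u + h + h) (v + k) (v + k + k)" by auto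
      have m: "(u + (u + h + h)) / 2 = u + h" "(v + (v + k + k)) / 2 = v + k" by auto
      have "P u (u + h + h) v (v + k + k)"
        by (rule step; (unfold m)?) (use I * hk in \<open>auto simp: inv_def p Ln add.assoc\<close>)
      then show False using I by (simp add: inv_def p Ln add.assoc)
    qed
    then obtain u' v' where uv: "u' \<in> {u, u + h}" "v' \<in> {v, v + k}" "\<not> P u' (u' + h) v' (v' + k)" by blast
    then have "inv (Suc n) (u', v')"
      using I hk by (auto simp: inv_def p Ln simp flip: h_def k_def)
    then show "\<exists>q. inv (Suc n) q \<and> fst q \<in> {fst p, fst p + L (Suc n)} \<and> snd q \<in> {snd p, snd p + H (Suc n)}"
      using uv(1,2) by (intro exI[of _ "(u', v')"]) (simp add: p flip: h_def k_def)
  qed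
  then obtain p where p: "\<And>n. inv n (p n)" and pS: "\<And>n. fst (p (Suc n)) \<in> {fst (p n), fst (p n) + L (Suc n)}"
    "\<And>n. snd (p (Suc n)) \<in> {snd (p n), snd (p n) + H (Suc n)}" by blast
  \<comment> \<open>Nested intervals, used once per coordinate.\<close>
  have nest: "\<exists>x. \<forall>n. x \<in> {u n..u n + l n}"
    if u: "\<And>n. u (Suc n) \<in> {u n, u n + l (Suc n)}" and l: "\<And>n. l n = l (Suc n) + l (Suc n)" "\<And>n. l n > 0"
    for u l :: "nat \<Rightarrow> real"
  proof -
    have 1: "u n \<le> u (Suc n)" "u (Suc n) + l (Suc n) \<le> u n + l n" for n
      using u[of n] l(1)[of n] l(2)[of "Suc n"] by auto
    have inc: "incseq u" and dec: "decseq (\<lambda>n. u n + l n)" using 1 by (auto intro: incseq_SucI decseq_SucI)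
    have le: "u n \<le> u m + l m" for n m
    proof -
      have "u n \<le> u (max n m)" using inc by (simp add: incseqD)
      also have "\<dots> \<le> u (max n m) + l (max n m)" using l(2)[of "max n m"] by simp
      also have "\<dots> \<le> u m + l m" using decseqD[OF dec, of m "max n m"] by simp
      finally show ?thesis .
    qed
    have "bdd_above (range u)" using le[of _ 0] by (intro bdd_aboveI2)
    then have "u n \<le> Sup (range u)" "Sup (range u) \<le> u n + l n" for n
      using le by (auto intro: cSUP_upper cSUP_least)
    then show ?thesis by auto
  qed
  obtain x where x: "\<And>n. x \<in> {fst (p n)..fst (p n) + L n}"
    using nest[of "\<lambda>n. fst (p n)" L] pS LH by blast
  obtain y where y: "\<And>n. y \<in> {snd (p n)..snd (p n) + H n}"
    using nest[of "\<lambda>n. snd (p n)" H] pS LH by blast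
  show ?thesis
  proof (rule that[of x y])
    fix e :: real assume "e > 0"
    have "L \<longlonglongrightarrow> 0" "H \<longlonglongrightarrow> 0" unfolding L_def H_def by (simp_all add: LIMSEQ_divide_realpow_zero)
    then have "\<forall>\<^sub>F n in sequentially. L n < e \<and> H n < e"
      using \<open>e > 0\<close> by (intro eventually_conj order_tendstoD(2))
    then obtain n where n: "L n < e" "H n < e" by (auto simp: eventually_sequentially)
    show "\<exists>a' b' c' d'. a \<le> a' \<and> a' < b' \<and> b' \<le> b \<and> c \<le> c' \<and> c' < d' \<and> d' \<le> d \<and>
      x \<in> {a'..b'} \<and> y \<in> {c'..d'} \<and> b' - a' < e \<and> d' - c' < e \<and>
      (b' - a') * (d - c) = (d' - c') * (b - a) \<and> \<not> P a' b' c' d'"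
      using p[of n] x[of n] y[of n] n LH(3,4)[of n]
      by (intro exI[of _ "fst (p n)"] exI[of _ "fst (p n) + L n"] exI[of _ "snd (p n)"] exI[of _ "snd (p n) + H n"])
         (auto simp: inv_def L_def H_def)
  qed
qed

section \<open>Area estimates, carried over between \<open>complex\<close> and pairs of
  reals\<close>

definition cplx :: "real \<times> real \<Rightarrow> complex" where
  "cplx p = Complex (fst p) (snd p)"

lemma continuous_on_cplx [continuous_intros]: "continuous_on A cplx"
  unfolding cplx_def Complex_eq by (intro continuous_intros)

lemma borel_measurable_cplx: "cplx \<in> borel_measurable borel"
  by (intro borel_measurable_continuous_onI continuous_intros)

lemma compact_cplx_vimage:
  assumes "compact E" shows "compact (cplx -` E)"
proof -
  have "cplx -` E = (\<lambda>z. (Re z, Im z)) ` E"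
    by (auto simp: cplx_def image_iff) (metis complex.sel)
  then show ?thesis
    using assms by (auto intro!: compact_continuous_image continuous_intros)
qed

text \<open>Exchanging the coordinates lets the estimate for vertical increments serve for
  horizontal ones.\<close>

lemma integral_lborel_swap:
  fixes g :: "real \<times> real \<Rightarrow> 'a::{banach, second_countable_topology}"
  assumes "g \<in> borel_measurable borel"
  shows "(\<integral>p. g (prod.swap p) \<partial>lborel) = (\<integral>p. g p \<partial>lborel)"
  using lborel_pair.integral_product_swap[of g] assms
  by (simp add: lborel_prod case_prod_unfold prod.swap_def)

lemma measure_lborel_swap:
  fixes A :: "(real \<times> real) set"
  assumes "A \<in> sets borel"
  shows "measure lborel (prod.swap -` A) = measure lborel A"
proof -
  have "measure lborel (prod.swap -` A) = (\<integral>p. indicator A (prod.swap p) \<partial>lborel)"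
  proof -
    have "prod.swap -` A \<in> sets borel"
      using assms by (intro measurable_sets_borel[of prod.swap borel A, simplified] borel_measurable_continuous_onI continuous_on_swap)
    then have "measure lborel (prod.swap -` A) = (\<integral>p. indicator (prod.swap -` A) p \<partial>lborel)"
      by simp
    also have "\<dots> = (\<integral>p. indicator A (prod.swap p) \<partial>lborel)" 
      by (simp only: indicator_vimage)
    finally show ?thesis .
  qed
  also have "\<dots> = measure lborel A"
    using assms by (subst integral_lborel_swap) auto
  finally show ?thesis .
qed

text \<open>The frame between the rectangles is cut into four rectangles, to the left, right, below
  and above; \<open>f\<close> is differentiable inside each, so each contributes 0.\<close>

lemma rect_integral_shrink:
  assumes cont: "continuous_on (rect a b c d) f"
    and le: "a \<le> a'" "a' \<le> b'" "b' \<le> b" "c \<le> c'" "c' \<le> d'" "d' \<le> d"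
    and diff: "\<And>z. z \<in> box (Complex a c) (Complex b d) - rect a' b' c' d' \<Longrightarrow> f field_differentiable at z"
  shows "rect_integral f a b c d = rect_integral f a' b' c' d'"
proof -
  have cs: "continuous_on (rect u v s t) f" if "a \<le> u" "v \<le> b" "c \<le> s" "t \<le> d" for u v s t
    by (rule continuous_on_subset[OF cont]) (use that in \<open>auto simp: in_cbox_complex_iff\<close>)
  have zero: "rect_integral f u v s t = 0"
    if "a \<le> u" "u \<le> v" "v \<le> b" "c \<le> s" "s \<le> t" "t \<le> d" "v \<le> a' \<or> b' \<le> u \<or> t \<le> c' \<or> d' \<le> s" for u v s t
  proof (rule rect_integral_eq_0)
    fix z assume "z \<in> box (Complex u s) (Complex v t)"
    then show "f field_differentiable at z"
      using that by (intro diff) (auto simp: in_box_complex_iff in_cbox_complex_iff)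
  qed (use that cs in auto)
  have "rect_integral f a b c d = rect_integral f a a' c d + rect_integral f a' b c d"
    by (rule rect_integral_split_Re) (use le cs in auto)
  also have "rect_integral f a a' c d = 0" by (rule zero) (use le in auto)
  also have "rect_integral f a' b c d = rect_integral f a' b' c d + rect_integral f b' b c d"
    by (rule rect_integral_split_Re) (use le cs in auto)
  also have "rect_integral f b' b c d = 0" by (rule zero) (use le in auto)
  also have "rect_integral f a' b' c d = rect_integral f a' b' c c' + rect_integral f a' b' c' d"
    by (rule rect_integral_split_Im) (use le cs in auto)
  also have "rect_integral f a' b' c c' = 0" by (rule zero) (use le in auto)
  also have "rect_integral f a' b' c' d = rect_integral f a' b' c' d' + rect_integral f a' b' d' d"
    by (rule rect_integral_split_Im) (use le cs in auto)
  also have "rect_integral f a' b' d' d = 0" by (rule zero) (use le in auto)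
  finally show ?thesis by simp
qed

lemma has_vector_derivative_at_shift:
  assumes "((\<lambda>t. g (t + x)) has_vector_derivative D) (at (0::real))"
  shows "(g has_vector_derivative D) (at x)"
proof -
  have "((\<lambda>t. t - x) has_vector_derivative 1) (at x)"
    by (auto intro!: derivative_eq_intros)
  from vector_diff_chain_at[OF this, of "\<lambda>t. g (t + x)" D] assms show ?thesis
    by (simp add: o_def)
qed

text \<open>Green's identity with an error term. After shrinking to the bounding box of
  \<open>E\<close> every side touches \<open>E\<close>, as the vertical estimate requires. The
  contour integral is \<open>\<i>\<close> times the integral of the horizontal increments minus that
  of the vertical ones. Up to the area off \<open>E\<close> these are the integrals of
  \<open>fx\<close> and \<open>fy\<close> over \<open>E\<close>, which cancel by \<open>CR\<close>.
  The two directions give the factor 2.\<close>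

lemma rect_integral_le_measure:
  fixes f fx fy :: "complex \<Rightarrow> complex"
  assumes ab: "a < b" "c < d" and asp: "b - a \<le> \<kappa> * (d - c)" "d - c \<le> \<kappa> * (b - a)"
    and cont: "continuous_on (rect a b c d) f"
    and E: "compact E" "E \<subseteq> rect a b c d"
    and diff: "\<And>z. z \<in> box (Complex a c) (Complex b d) - E \<Longrightarrow> f field_differentiable at z"
    and "N \<ge> 0"
    and lip: "\<And>z w. z \<in> E \<Longrightarrow> w \<in> rect a b c d \<Longrightarrow> Re w = Re z \<or> Im w = Im z \<Longrightarrow>
        norm (f w - f z) \<le> N * norm (w - z)"
    and dx: "\<And>z. z \<in> E \<Longrightarrow> ((\<lambda>t. f (z + of_real t)) has_vector_derivative fx z) (at 0)"
    and dy: "\<And>z. z \<in> E \<Longrightarrow> ((\<lambda>t. f (z + \<i> * of_real t)) has_vector_derivative fy z) (at 0)"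
    and bounds: "\<And>z. z \<in> E \<Longrightarrow> norm (fx z) \<le> N" "\<And>z. z \<in> E \<Longrightarrow> norm (fy z) \<le> N"
    and meas: "(\<lambda>p. indicator E (cplx p) *\<^sub>R fx (cplx p)) \<in> borel_measurable borel"
      "(\<lambda>p. indicator E (cplx p) *\<^sub>R fy (cplx p)) \<in> borel_measurable borel"
    and CR: "\<And>z. z \<in> E \<Longrightarrow> fx z + \<i> * fy z = 0"
  shows "norm (rect_integral f a b c d) \<le> 2 * ((3 * \<kappa> + 4) * N) * measure lborel ({a..b} \<times> {c..d} - cplx -` E)"
proof (cases "E = {}")
  case True
  then have "rect_integral f a b c d = 0" using ab diff cont by (intro rect_integral_eq_0) auto
  moreover have "\<kappa> \<ge> 0" using asp ab
    by (smt (verit) mult_nonneg_nonpos2 mult_nonpos_nonneg)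
  ultimately show ?thesis using \<open>N \<ge> 0\<close> by simp
next
  case False
  obtain za where za: "za \<in> E" "\<And>z. z \<in> E \<Longrightarrow> Re za \<le> Re z"
    using continuous_attains_inf[OF E(1) False continuous_on_Re[OF continuous_on_id]] by auto
  obtain zb where zb: "zb \<in> E" "\<And>z. z \<in> E \<Longrightarrow> Re z \<le> Re zb"
    using continuous_attains_sup[OF E(1) False continuous_on_Re[OF continuous_on_id]] by auto
  obtain zc where zc: "zc \<in> E" "\<And>z. z \<in> E \<Longrightarrow> Im zc \<le> Im z"
    using continuous_attains_inf[OF E(1) False continuous_on_Im[OF continuous_on_id]] by auto
  obtain zd where zd: "zd \<in> E" "\<And>z. z \<in> E \<Longrightarrow> Im z \<le> Im zd"
    using continuous_attains_sup[OF E(1) False continuous_on_Im[OF continuous_on_id]] by auto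
  define a' b' c' d' where "a' = Re za" and "b' = Re zb" and "c' = Im zc" and "d' = Im zd"
  have inQ: "Re z \<in> {a..b}" "Im z \<in> {c..d}" if "z \<in> E" for z
    using that E(2) by (auto simp: in_cbox_complex_iff)
  have le: "a \<le> a'" "a' \<le> b'" "b' \<le> b" "c \<le> c'" "c' \<le> d'" "d' \<le> d"
    using inQ za zb zc zd by (auto simp: a'_def b'_def c'_def d'_def)
  have E': "Re z \<in> {a'..b'}" "Im z \<in> {c'..d'}" if "z \<in> E" for z
    using that za zb zc zd by (auto simp: a'_def b'_def c'_def d'_def)
  have eq: "rect_integral f a b c d = rect_integral f a' b' c' d'"
    by (rule rect_integral_shrink[OF cont le], rule diff) (use E' in \<open>auto simp: in_cbox_complex_iff\<close>)
  let ?E = "cplx -` E"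
  let ?Q = "{a..b} \<times> {c..d}"
  have Ec: "compact ?E" by (rule compact_cplx_vimage[OF E(1)])
  have ind: "indicator E (cplx p) = (indicator ?E p :: real)" for p by (auto simp: indicator_def)
  define Ix Iy where "Ix = (\<integral>p. indicator ?E p *\<^sub>R fx (cplx p) \<partial>lborel)" and "Iy = (\<integral>p. indicator ?E p *\<^sub>R fy (cplx p) \<partial>lborel)"
  have lip1: "norm (f (Complex x' y) - f (Complex x y)) \<le> N * \<bar>x' - x\<bar>" if "Complex x y \<in> E" "x' \<in> {a..b}" for x y x'
    using lip[of "Complex x y" "Complex x' y"] that E(2) by (auto simp: in_cbox_complex_iff cmod_def)
  have lip2: "norm (f (Complex x y') - f (Complex x y)) \<le> N * \<bar>y' - y\<bar>" if "Complex x y \<in> E" "y' \<in> {c..d}" for x y y'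
    using lip[of "Complex x y" "Complex x y'"] that E(2) by (auto simp: in_cbox_complex_iff cmod_def)
  have V: "norm (integral {a'..b'} (\<lambda>x. (f \<circ> cplx) (x, d') - (f \<circ> cplx) (x, c')) - (\<integral>p. indicator ?E p *\<^sub>R (fy \<circ> cplx) p \<partial>lborel))
      \<le> (3 * \<kappa> + 4) * N * measure lborel (?Q - ?E)"
  proof (rule vertical_increment_minus_integral_le)
    show "?E \<subseteq> {a'..b'} \<times> {c'..d'}" using E' by (force simp: cplx_def)
    show "(Re zc, c') \<in> ?E" "(Re zd, d') \<in> ?E" using zc zd by (auto simp: cplx_def c'_def d'_def)
    show "((\<lambda>t. (f \<circ> cplx) (x, t)) has_vector_derivative (fy \<circ> cplx) (x, y)) (at y)" if "(x, y) \<in> ?E" for x y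
    proof (rule has_vector_derivative_at_shift)
      have "cplx (x, t + y) = cplx (x, y) + \<i> * of_real t" for t by (simp add: cplx_def complex_eq_iff)
      then show "((\<lambda>t. (f \<circ> cplx) (x, t + y)) has_vector_derivative (fy \<circ> cplx) (x, y)) (at 0)"
        using dy[of "cplx (x, y)"] that by simp
    qed
    show "continuous_on ?Q (f \<circ> cplx)"
      by (intro continuous_on_compose continuous_intros continuous_on_subset[OF cont])
         (auto simp: cplx_def in_cbox_complex_iff)
    show "(\<lambda>p. indicator ?E p *\<^sub>R (fy \<circ> cplx) p) \<in> borel_measurable borel"
      using meas(2) by (simp add: ind)
  qed (use Ec le \<open>N \<ge> 0\<close> lip1 lip2 asp bounds in \<open>auto simp: cplx_def\<close>)
  let ?E2 = "prod.swap -` ?E"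
  let ?Q2 = "{c..d} \<times> {a..b}"
  have ind2: "indicator ?E2 p = (indicator E (cplx (prod.swap p)) :: real)" for p by (auto simp: indicator_def)
  have Hr: "norm (integral {c'..d'} (\<lambda>y. (f \<circ> cplx \<circ> prod.swap) (y, b') - (f \<circ> cplx \<circ> prod.swap) (y, a')) - (\<integral>p. indicator ?E2 p *\<^sub>R (fx \<circ> cplx \<circ> prod.swap) p \<partial>lborel))
      \<le> (3 * \<kappa> + 4) * N * measure lborel (?Q2 - ?E2)"
  proof (rule vertical_increment_minus_integral_le)
    have "p \<in> prod.swap ` ?E" if "p \<in> ?E2" for p
      using that by (metis imageI swap_swap vimageD)
    then have "?E2 = prod.swap ` ?E" by auto
    then show "compact ?E2" using Ec by (auto intro!: compact_continuous_image continuous_on_swap)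
    show "?E2 \<subseteq> {c'..d'} \<times> {a'..b'}" using E' by (force simp: cplx_def)
    show "(Im za, a') \<in> ?E2" "(Im zb, b') \<in> ?E2" using za zb by (auto simp: cplx_def a'_def b'_def)
    show "((\<lambda>t. (f \<circ> cplx \<circ> prod.swap) (y, t)) has_vector_derivative (fx \<circ> cplx \<circ> prod.swap) (y, x)) (at x)" if "(y, x) \<in> ?E2" for x y
    proof (rule has_vector_derivative_at_shift)
      have "cplx (t + x, y) = cplx (x, y) + of_real t" for t by (simp add: cplx_def complex_eq_iff)
      then show "((\<lambda>t. (f \<circ> cplx \<circ> prod.swap) (y, t + x)) has_vector_derivative (fx \<circ> cplx \<circ> prod.swap) (y, x)) (at 0)"
        using dx[of "cplx (x, y)"] that by simp
    qed
    show "continuous_on ?Q2 (f \<circ> cplx \<circ> prod.swap)"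
      by (intro continuous_on_compose continuous_intros continuous_on_subset[OF cont] continuous_on_swap)
         (auto simp: cplx_def in_cbox_complex_iff)
    have "(\<lambda>p. (\<lambda>p. indicator E (cplx p) *\<^sub>R fx (cplx p)) (prod.swap p)) \<in> borel_measurable borel"
      by (rule measurable_compose[OF borel_measurable_continuous_onI meas(1)]) (rule continuous_on_swap)
    then show "(\<lambda>p. indicator ?E2 p *\<^sub>R (fx \<circ> cplx \<circ> prod.swap) p) \<in> borel_measurable borel"
      by (simp add: ind2)
  qed (use le \<open>N \<ge> 0\<close> lip1 lip2 asp bounds in \<open>auto simp: cplx_def\<close>)
  have "?Q2 - ?E2 = prod.swap -` (?Q - ?E)" by auto
  moreover have "?Q - ?E \<in> sets borel"
    using compact_imp_closed[OF Ec] by (intro sets.Diff borel_closed closed_Times) auto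
  ultimately have mQ: "measure lborel (?Q2 - ?E2) = measure lborel (?Q - ?E)"
    using measure_lborel_swap by metis
  have IxE: "(\<integral>p. indicator ?E2 p *\<^sub>R (fx \<circ> cplx \<circ> prod.swap) p \<partial>lborel) = Ix"
    using integral_lborel_swap[OF meas(1)] by (simp add: Ix_def ind2 flip: ind)
  have IyE: "(\<integral>p. indicator ?E p *\<^sub>R (fy \<circ> cplx) p \<partial>lborel) = Iy" by (simp add: Iy_def)
  have "\<i> * Ix - Iy = 0"
  proof -
    have *: "indicator ?E p *\<^sub>R fy (cplx p) = \<i> * (indicator ?E p *\<^sub>R fx (cplx p))" for p
    proof (cases "p \<in> ?E")
      case True
      then have "fx (cplx p) = - (\<i> * fy (cplx p))" using CR[of "cplx p"] by (simp add: eq_neg_iff_add_eq_0)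
      then show ?thesis by simp
    qed auto
    have "Iy = \<i> * Ix" unfolding Ix_def Iy_def * by (rule integral_mult_right_zero)
    then show ?thesis by simp
  qed
  define A where "A = integral {a'..b'} (\<lambda>x. f (Complex x d') - f (Complex x c'))"
  define B where "B = integral {c'..d'} (\<lambda>y. f (Complex b' y) - f (Complex a' y))"
  have cont': "continuous_on (rect a' b' c' d') f"
    by (rule continuous_on_subset[OF cont]) (use le in \<open>auto simp: in_cbox_complex_iff\<close>)
  have "A = integral {a'..b'} (\<lambda>x. f (Complex x d')) - integral {a'..b'} (\<lambda>x. f (Complex x c'))"
    unfolding A_def using le
    by (intro Henstock_Kurzweil_Integration.integral_diff integrable_continuous_real continuous_on_horizontal[OF cont']) auto
  moreover have "B = integral {c'..d'} (\<lambda>y. f (Complex b' y)) - integral {c'..d'} (\<lambda>y. f (Complex a' y))"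
    unfolding B_def using le
    by (intro Henstock_Kurzweil_Integration.integral_diff integrable_continuous_real continuous_on_vertical[OF cont']) auto
  ultimately have "rect_integral f a' b' c' d' = \<i> * B - A" by (simp add: rect_integral_def)
  also have "\<dots> = \<i> * (B - Ix) - (A - Iy)" using \<open>\<i> * Ix - Iy = 0\<close> by (simp add: algebra_simps)
  finally have "norm (rect_integral f a b c d) \<le> norm (\<i> * (B - Ix)) + norm (A - Iy)"
    unfolding eq by (metis norm_triangle_ineq4)
  also have "\<dots> \<le> 2 * ((3 * \<kappa> + 4) * N) * measure lborel (?Q - ?E)"
    using V Hr unfolding mQ IxE IyE by (simp add: A_def B_def cplx_def norm_mult)
  finally show ?thesis .
qed

lemma has_vector_derivative_at_0_quotient:
  fixes g :: "real \<Rightarrow> 'a::real_normed_vector"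
  assumes "(g has_vector_derivative D) (at 0)"
  shows "((\<lambda>h. (g h - g 0) /\<^sub>R h) \<longlongrightarrow> D) (at 0)"
proof -
  have "((\<lambda>h. norm (g (0 + h) - g 0 - h *\<^sub>R D) / norm h) \<longlongrightarrow> 0) (at 0)"
    using assms unfolding has_vector_derivative_def has_derivative_at by blast
  moreover have "\<forall>\<^sub>F h in at (0::real). norm (g (0 + h) - g 0 - h *\<^sub>R D) / norm h = norm ((g h - g 0) /\<^sub>R h - D)"
    using eventually_neq_at_within[of 0 0 UNIV]
  proof eventually_elim
    case (elim h)
    then have "(g h - g 0) /\<^sub>R h - D = (g (0 + h) - g 0 - h *\<^sub>R D) /\<^sub>R h"
      by (simp add: scaleR_right_diff_distrib)
    then show ?case by (simp add: divide_inverse mult.commute)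
  qed
  ultimately have "((\<lambda>h. norm ((g h - g 0) /\<^sub>R h - D)) \<longlongrightarrow> 0) (at 0)"
    by (rule Lim_transform_eventually)
  then show ?thesis using tendsto_norm_zero_iff LIM_zero_iff by blast
qed

text \<open>On \<open>E\<close> the derivative is the pointwise limit of difference quotients with
  steps \<open>1 / (n + 1)\<close>, each of them Borel.\<close>

lemma borel_measurable_directional_derivative:
  fixes f D :: "complex \<Rightarrow> complex"
  assumes U: "open U" and cont: "continuous_on U f" and E: "E \<in> sets borel" "E \<subseteq> U"
    and deriv: "\<And>z. z \<in> E \<Longrightarrow> ((\<lambda>t. f (z + v * of_real t)) has_vector_derivative D z) (at 0)"
  shows "(\<lambda>z. indicator E z *\<^sub>R D z) \<in> borel_measurable borel"
proof (rule borel_measurable_LIMSEQ_metric)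
  \<comment> \<open>Extension by 0, because the shifted point may lie outside \<open>U\<close> for
    small \<open>n\<close>.\<close>
  define f0 where "f0 z = indicator U z *\<^sub>R f z" for z
  have f0: "f0 \<in> borel_measurable borel"
    unfolding f0_def using U cont by (intro borel_measurable_continuous_on_indicator) auto
  define q where "q n z = indicator E z *\<^sub>R (real (Suc n) *\<^sub>R (f0 (z + v * of_real (inverse (real (Suc n)))) - f0 z))" for n z
  show "q n \<in> borel_measurable borel" for n
  proof -
    have "(\<lambda>z. f0 (z + v * of_real (inverse (real (Suc n))))) \<in> borel_measurable borel"
      by (rule measurable_compose[OF _ f0]) (intro borel_measurable_continuous_onI continuous_intros)
    then show ?thesis unfolding q_def using f0 E by measurable
  qed
  show "(\<lambda>n. q n z) \<longlonglongrightarrow> indicator E z *\<^sub>R D z" for z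
  proof (cases "z \<in> E")
    case True
    have lim: "(\<lambda>n. z + v * of_real (inverse (real (Suc n)))) \<longlonglongrightarrow> z + v * of_real 0"
      by (intro tendsto_intros LIMSEQ_inverse_real_of_nat)
    have ev: "\<forall>\<^sub>F n in sequentially. z + v * of_real (inverse (real (Suc n))) \<in> U"
      using topological_tendstoD[OF lim U] E True by auto
    have "((\<lambda>h. (f (z + v * of_real h) - f (z + v * of_real 0)) /\<^sub>R h) \<longlongrightarrow> D z) (at 0)"
      using has_vector_derivative_at_0_quotient[OF deriv[OF True]] .
    moreover have "filterlim (\<lambda>n. inverse (real (Suc n))) (at 0) sequentially"
      unfolding filterlim_at using LIMSEQ_inverse_real_of_nat by (auto simp: eventually_sequentially)
    ultimately have "(\<lambda>n. (f (z + v * of_real (inverse (real (Suc n)))) - f (z + v * of_real 0)) /\<^sub>R inverse (real (Suc n))) \<longlonglongrightarrow> D z"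
      by (rule filterlim_compose)
    moreover have "\<forall>\<^sub>F n in sequentially. (f (z + v * of_real (inverse (real (Suc n)))) - f (z + v * of_real 0)) /\<^sub>R inverse (real (Suc n)) = q n z"
      using ev by eventually_elim (use True E(2) in \<open>auto simp: q_def f0_def\<close>)
    ultimately have "(\<lambda>n. q n z) \<longlonglongrightarrow> D z"
      by (rule Lim_transform_eventually)
    then show ?thesis using True by simp
  qed (simp add: q_def)
qed

lemma norm_vector_derivative_le:
  fixes g :: "real \<Rightarrow> 'a::real_normed_vector"
  assumes "(g has_vector_derivative D) (at 0)" "\<forall>\<^sub>F t in at 0. norm (g t - g 0) \<le> N * \<bar>t\<bar>"
  shows "norm D \<le> N"
proof -
  have "\<forall>\<^sub>F h in at 0. norm ((g h - g 0) /\<^sub>R h) \<le> N"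
    using assms(2) eventually_neq_at_within[of 0 0 UNIV]
  proof eventually_elim
    case (elim h)
    have "norm ((g h - g 0) /\<^sub>R h) = norm (g h - g 0) / \<bar>h\<bar>" by (simp add: divide_inverse mult.commute)
    then show ?case using elim by (simp add: pos_divide_le_eq)
  qed
  then show ?thesis
    using has_vector_derivative_at_0_quotient[OF assms(1)]
    by (intro Lim_norm_ubound[OF trivial_limit_at])
qed

text \<open>The two halves overlap in a null set; this makes area additive under bisection.\<close>

lemma measure_rect_split:
  fixes S :: "(real \<times> real) set"
  assumes S: "S \<in> sets borel"
  shows "a \<le> m \<Longrightarrow> m \<le> b \<Longrightarrow> measure lborel ({a..b} \<times> {c..d} \<inter> S) =
      measure lborel ({a..m} \<times> {c..d} \<inter> S) + measure lborel ({m..b} \<times> {c..d} \<inter> S)" (is "_ \<Longrightarrow> _ \<Longrightarrow> ?A")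
    and "c \<le> m \<Longrightarrow> m \<le> d \<Longrightarrow> measure lborel ({a..b} \<times> {c..d} \<inter> S) =
      measure lborel ({a..b} \<times> {c..m} \<inter> S) + measure lborel ({a..b} \<times> {m..d} \<inter> S)" (is "_ \<Longrightarrow> _ \<Longrightarrow> ?B")
proof -
  have fm: "{u..v} \<times> {s..t} \<inter> S \<in> fmeasurable lborel" for u v s t
    by (rule fmeasurableI2[OF fmeasurable_cbox[of "(u, s)" "(v, t)"]])
       (use S in \<open>auto simp: cbox_Pair_eq intro!: sets.Int borel_closed[OF closed_Times]\<close>)
  have hyper: "AE p in lborel. p \<bullet> k \<noteq> m" if "k \<in> Basis" for k :: "real \<times> real"
  proof -
    have "{x. x \<bullet> k = m} \<in> null_sets lebesgue"
      using negligible_standard_hyperplane[OF that] by (simp add: negligible_iff_null_sets)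
    moreover have "closed {x. x \<bullet> k = m}" by (intro closed_Collect_eq continuous_intros)
    ultimately have "{x. x \<bullet> k = m} \<in> null_sets lborel"
      by (simp add: null_sets_completion_iff)
    then show ?thesis using AE_iff_null_sets[of "{x. x \<bullet> k = m}" lborel] by (simp add: null_setsD2)
  qed
  show ?A if "a \<le> m" "m \<le> b"
  proof -
    have "{a..b} \<times> {c..d} \<inter> S = ({a..m} \<times> {c..d} \<inter> S) \<union> ({m..b} \<times> {c..d} \<inter> S)"
      using that by auto
    then show ?thesis
    proof (simp only:, intro measure_Un_AE[OF _ fm fm])
      show "AE p in lborel. p \<notin> {a..m} \<times> {c..d} \<inter> S \<or> p \<notin> {m..b} \<times> {c..d} \<inter> S"
        using hyper[of "(1, 0)"] by (rule AE_mp) (auto simp: Basis_prod_def inner_prod_def)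
    qed
  qed
  show ?B if "c \<le> m" "m \<le> d"
  proof -
    have "{a..b} \<times> {c..d} \<inter> S = ({a..b} \<times> {c..m} \<inter> S) \<union> ({a..b} \<times> {m..d} \<inter> S)"
      using that by auto
    then show ?thesis
    proof (simp only:, intro measure_Un_AE[OF _ fm fm])
      show "AE p in lborel. p \<notin> {a..b} \<times> {c..m} \<inter> S \<or> p \<notin> {a..b} \<times> {m..d} \<inter> S"
        using hyper[of "(0, 1)"] by (rule AE_mp) (auto simp: Basis_prod_def inner_prod_def)
    qed
  qed
qed

text \<open>Bisection is applied to the inequality between the rectangle integral and \<open>C\<close> times the measure of
  the part of the rectangle in \<open>T - E\<close>, where \<open>T\<close> is an open neighbourhood of \<open>E\<close> with little excess
  measure. Small rectangles lie either in \<open>D\<close>, where the integral vanishes, or in \<open>T\<close>. Bisection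
  preserves the aspect ratio, on which the constant \<open>C\<close> depends.\<close>

lemma rect_integral_eq_0_if_lipschitz_from:
  fixes f fx fy :: "complex \<Rightarrow> complex"
  assumes U: "open U" and D: "open D" "D \<subseteq> U" and hol: "f holomorphic_on D" and cont: "continuous_on U f"
    and N: "N \<ge> 0"
    and lip: "\<And>z w. z \<in> U - D \<Longrightarrow> w \<in> U \<Longrightarrow> Re w = Re z \<or> Im w = Im z \<Longrightarrow> norm (f w - f z) \<le> N * norm (w - z)"
    and dx: "\<And>z. z \<in> U - D \<Longrightarrow> ((\<lambda>t. f (z + of_real t)) has_vector_derivative fx z) (at 0)"
    and dy: "\<And>z. z \<in> U - D \<Longrightarrow> ((\<lambda>t. f (z + \<i> * of_real t)) has_vector_derivative fy z) (at 0)"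
    and CR: "\<And>z. z \<in> U - D \<Longrightarrow> fx z + \<i> * fy z = 0"
    and ab: "a < b" "c < d" and sub: "rect a b c d \<subseteq> U"
  shows "rect_integral f a b c d = 0"
proof (rule ccontr)
  assume ne: "rect_integral f a b c d \<noteq> 0"
  define E where "E = U - D"
  have Eb: "E \<in> sets borel" unfolding E_def using U D by auto
  \<comment> \<open>Small shifts along an axis stay in \<open>U\<close>, so \<open>lip\<close>
    bounds the difference quotients and hence the partial derivatives.\<close>
  have bd: "norm (g z) \<le> N"
    if z: "z \<in> E" and v: "v \<in> {1, \<i>}" and g: "((\<lambda>t. f (z + v * of_real t)) has_vector_derivative g z) (at 0)" for z v g
  proof (rule norm_vector_derivative_le[OF g])
    have "((\<lambda>t. z + v * of_real t) \<longlongrightarrow> z + v * of_real 0) (at (0::real))" by (intro tendsto_intros)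
    from topological_tendstoD[OF this U] z have "\<forall>\<^sub>F t in at (0::real). z + v * of_real t \<in> U" by (auto simp: E_def)
    then show "\<forall>\<^sub>F t in at 0. norm (f (z + v * of_real t) - f (z + v * of_real 0)) \<le> N * \<bar>t\<bar>"
    proof eventually_elim
      case (elim t)
      have "norm (f (z + v * of_real t) - f z) \<le> N * norm (z + v * of_real t - z)"
        by (rule lip) (use z v elim in \<open>auto simp: E_def\<close>)
      also have "norm (z + v * of_real t - z) = \<bar>t\<bar>" using v by (auto simp: norm_mult)
      finally show ?case by simp
    qed
  qed
  \<comment> \<open>The larger of the two aspect ratios, since the estimate is applied in both
    directions. All rectangles of the bisection share it, so \<open>C\<close> is fixed.\<close>
  define \<kappa> where "\<kappa> = max ((b - a) / (d - c)) ((d - c) / (b - a))"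
  have \<kappa>: "\<kappa> > 0" using ab by (auto simp: \<kappa>_def max_def)
  define C where "C = 2 * ((3 * \<kappa> + 4) * N)"
  have C: "C \<ge> 0" using \<kappa> N by (simp add: C_def)
  let ?E = "cplx -` E"
  have E2b: "?E \<in> sets borel" using measurable_sets_borel[OF borel_measurable_cplx Eb] by simp
  have sub': "rect a' b' c' d' \<subseteq> rect a b c d" if "a \<le> a'" "b' \<le> b" "c \<le> c'" "d' \<le> d" for a' b' c' d'
    using that by (auto simp: in_cbox_complex_iff)
  have bnd: "norm (rect_integral f a' b' c' d') \<le> C * measure lborel ({a'..b'} \<times> {c'..d'} - ?E)"
    if le: "a \<le> a'" "a' < b'" "b' \<le> b" "c \<le> c'" "c' < d'" "d' \<le> d"
      and asp: "(b' - a') * (d - c) = (d' - c') * (b - a)" for a' b' c' d'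
  proof -
    let ?R = "rect a' b' c' d'"
    have RU: "?R \<subseteq> U" using sub' le sub by blast
    have eqR: "E \<inter> ?R = ?R - D" using RU by (auto simp: E_def)
    have ER: "compact (E \<inter> ?R)" unfolding eqR using D by (intro compact_diff) auto
    have m: "(\<lambda>p. indicator (E \<inter> ?R) (cplx p) *\<^sub>R g (cplx p)) \<in> borel_measurable borel"
      if g: "\<And>z. z \<in> E \<Longrightarrow> ((\<lambda>t. f (z + v * of_real t)) has_vector_derivative g z) (at 0)" for g v
    proof (rule measurable_compose[OF borel_measurable_cplx])
      show "(\<lambda>z. indicator (E \<inter> ?R) z *\<^sub>R g z) \<in> borel_measurable borel"
        by (rule borel_measurable_directional_derivative[OF U cont]) (use g Eb in \<open>auto simp: E_def\<close>)
    qed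
    have "norm (rect_integral f a' b' c' d') \<le> C * measure lborel ({a'..b'} \<times> {c'..d'} - cplx -` (E \<inter> ?R))"
      unfolding C_def
    proof (rule rect_integral_le_measure[where fx = fx and fy = fy])
      have "b' - a' = (d' - c') * ((b - a) / (d - c))" "d' - c' = (b' - a') * ((d - c) / (b - a))"
        using asp ab by (auto simp: field_simps)
      moreover have "(d' - c') * ((b - a) / (d - c)) \<le> (d' - c') * \<kappa>" "(b' - a') * ((d - c) / (b - a)) \<le> (b' - a') * \<kappa>"
        using le by (auto simp: \<kappa>_def simp del: times_divide_eq_right intro!: mult_left_mono)
      ultimately show "b' - a' \<le> \<kappa> * (d' - c')" "d' - c' \<le> \<kappa> * (b' - a')" by (simp_all add: mult.commute)
      show "f field_differentiable at z" if "z \<in> box (Complex a' c') (Complex b' d') - E \<inter> ?R" for z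
      proof -
        have "z \<in> D" using that RU box_subset_cbox[of "Complex a' c'" "Complex b' d'"] by (auto simp: E_def)
        then show ?thesis using hol D by (simp add: holomorphic_on_imp_differentiable_at)
      qed
      show "(\<lambda>p. indicator (E \<inter> ?R) (cplx p) *\<^sub>R fx (cplx p)) \<in> borel_measurable borel"
        by (rule m[of 1]) (use dx in \<open>simp add: E_def\<close>)
      show "(\<lambda>p. indicator (E \<inter> ?R) (cplx p) *\<^sub>R fy (cplx p)) \<in> borel_measurable borel"
        by (rule m[of \<i>]) (use dy in \<open>simp add: E_def\<close>)
      show "norm (fx z) \<le> N" if "z \<in> E \<inter> ?R" for z
        using bd[of z 1 fx] dx that by (auto simp: E_def)
      show "norm (fy z) \<le> N" if "z \<in> E \<inter> ?R" for z
        using bd[of z \<i> fy] dy that by (auto simp: E_def)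
      show "continuous_on ?R f" using continuous_on_subset[OF cont RU] .
      show "norm (f w - f z) \<le> N * norm (w - z)" if "z \<in> E \<inter> ?R" "w \<in> ?R" "Re w = Re z \<or> Im w = Im z" for z w
        using lip[of z w] that RU by (auto simp: E_def)
    qed (use le ER N dx dy CR in \<open>auto simp: E_def\<close>)
    also have "{a'..b'} \<times> {c'..d'} - cplx -` (E \<inter> ?R) = {a'..b'} \<times> {c'..d'} - ?E"
      by (auto simp: cplx_def in_cbox_complex_iff)
    finally show ?thesis .
  qed
  \<comment> \<open>Chosen so that \<open>C * e\<close> is smaller than the norm of the integral;
    the summand 1 covers \<open>C = 0\<close>.\<close>
  define e where "e = norm (rect_integral f a b c d) / (C + 1)"
  have e: "e > 0" using ne C by (simp add: e_def)
  let ?S = "cplx -` (E \<inter> rect a b c d)"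
  have "E \<inter> rect a b c d = rect a b c d - D" using sub by (auto simp: E_def)
  then have "compact (E \<inter> rect a b c d)" using D by (simp add: compact_diff)
  then have Sc: "compact ?S" by (rule compact_cplx_vimage)
  have "?S \<in> sets lebesgue" using compact_imp_closed[OF Sc] by simp
  from sets_lebesgue_outer_open[OF this e] obtain T where T: "open T" "?S \<subseteq> T"
    "T - ?S \<in> lmeasurable" "emeasure lebesgue (T - ?S) < ennreal e" by blast
  have mT: "measure lebesgue (T - ?S) < e"
    using T(4) unfolding emeasure_eq_measure2[OF T(3)] by (rule ennreal_less_iff[OF measure_nonneg, THEN iffD1])
  \<comment> \<open>Unlike the area off \<open>E\<close>, this area is at most \<open>e\<close> on
    the large rectangle. For rectangles inside \<open>T\<close> the two areas agree, so
    \<open>bnd\<close> yields \<open>P\<close> on small rectangles at points of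
    \<open>E\<close>.\<close>
  define \<mu> where "\<mu> a' b' c' d' = measure lborel ({a'..b'} \<times> {c'..d'} \<inter> (T - ?E))" for a' b' c' d'
  have TE: "T - ?E \<in> sets borel" using T(1) E2b by auto
  define P where "P a' b' c' d' \<longleftrightarrow> norm (rect_integral f a' b' c' d') \<le> C * \<mu> a' b' c' d'" for a' b' c' d'
  have "P a b c d"
  proof (rule ccontr)
    assume nP: "\<not> P a b c d"
    have stp: "P a' b' c' d'"
      if le: "a \<le> a'" "a' < b'" "b' \<le> b" "c \<le> c'" "c' < d'" "d' \<le> d"
        and q: "P a' ((a' + b') / 2) c' ((c' + d') / 2)" "P ((a' + b') / 2) b' c' ((c' + d') / 2)"
          "P a' ((a' + b') / 2) ((c' + d') / 2) d'" "P ((a' + b') / 2) b' ((c' + d') / 2) d'" for a' b' c' d'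
    proof -
      define m n where "m = (a' + b') / 2" and "n = (c' + d') / 2"
      have mn: "a' \<le> m" "m \<le> b'" "c' \<le> n" "n \<le> d'" using le by (auto simp: m_def n_def)
      have cn: "continuous_on (rect s t u v) f" if "a \<le> s" "t \<le> b" "c \<le> u" "v \<le> d" for s t u v
        using continuous_on_subset[OF cont] sub' sub that by (meson order_trans)
      have "rect_integral f a' b' c' d' = rect_integral f a' m c' d' + rect_integral f m b' c' d'"
        by (rule rect_integral_split_Re) (use le mn cn in auto)
      moreover have "rect_integral f a' m c' d' = rect_integral f a' m c' n + rect_integral f a' m n d'"
        by (rule rect_integral_split_Im) (use le mn cn in auto)
      moreover have "rect_integral f m b' c' d' = rect_integral f m b' c' n + rect_integral f m b' n d'"
        by (rule rect_integral_split_Im) (use le mn cn in auto)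
      ultimately have "norm (rect_integral f a' b' c' d') =
          norm ((rect_integral f a' m c' n + rect_integral f a' m n d') + (rect_integral f m b' c' n + rect_integral f m b' n d'))"
        by (simp only:)
      also have "\<dots> \<le> norm (rect_integral f a' m c' n) + norm (rect_integral f a' m n d')
          + (norm (rect_integral f m b' c' n) + norm (rect_integral f m b' n d'))"
        by (intro norm_triangle_mono order_refl norm_triangle_ineq)
      also have "\<dots> \<le> C * \<mu> a' m c' n + C * \<mu> a' m n d' + (C * \<mu> m b' c' n + C * \<mu> m b' n d')"
        using q unfolding P_def m_def[symmetric] n_def[symmetric] by (intro add_mono)
      also have "\<dots> = C * \<mu> a' b' c' d'"
        unfolding \<mu>_def
        using measure_rect_split(1)[OF TE mn(1,2), of c' d'] measure_rect_split(2)[OF TE mn(3,4), of a' m]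
          measure_rect_split(2)[OF TE mn(3,4), of m b']
        by (simp only: distrib_left)
      finally show ?thesis unfolding P_def .
    qed
    obtain x y where xy: "\<And>e. e > 0 \<Longrightarrow> \<exists>a' b' c' d'. a \<le> a' \<and> a' < b' \<and> b' \<le> b \<and> c \<le> c' \<and> c' < d' \<and> d' \<le> d \<and>
      x \<in> {a'..b'} \<and> y \<in> {c'..d'} \<and> b' - a' < e \<and> d' - c' < e \<and>
      (b' - a') * (d - c) = (d' - c') * (b - a) \<and> \<not> P a' b' c' d'"
      using rect_bisection[of a b c d P, OF ab nP stp] by blast
    have "x \<in> {a..b}" "y \<in> {c..d}" using xy[of 1] by auto
    then have xyR: "Complex x y \<in> rect a b c d" by (auto simp: in_cbox_complex_iff)
    show False
    proof (cases "Complex x y \<in> D")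
      case True
      then obtain r where r: "r > 0" "ball (Complex x y) r \<subseteq> D" using D(1) open_contains_ball by blast
      obtain a' b' c' d' where R: "a \<le> a'" "a' < b'" "b' \<le> b" "c \<le> c'" "c' < d'" "d' \<le> d"
        "x \<in> {a'..b'}" "y \<in> {c'..d'}" "b' - a' < r / 2" "d' - c' < r / 2" "\<not> P a' b' c' d'"
        using xy[of "r / 2"] r(1) by auto
      have "rect a' b' c' d' \<subseteq> D"
      proof
        fix z assume z: "z \<in> rect a' b' c' d'"
        have "norm (Complex x y - z) \<le> \<bar>Re (Complex x y - z)\<bar> + \<bar>Im (Complex x y - z)\<bar>" by (rule cmod_le)
        also have "\<dots> < r" using z R by (auto simp: in_cbox_complex_iff)
        finally show "z \<in> D" using r(2) by (auto simp: dist_norm)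
      qed
      then have "rect_integral f a' b' c' d' = 0"
        using R D hol sub box_subset_cbox[of "Complex a' c'" "Complex b' d'"]
        by (intro rect_integral_eq_0 continuous_on_subset[OF cont] holomorphic_on_imp_differentiable_at[OF hol D(1)]) auto
      then show False using R C by (simp add: P_def \<mu>_def)
    next
      case False
      then have "(x, y) \<in> ?S" using xyR sub by (auto simp: cplx_def E_def)
      then have "(x, y) \<in> T" using T(2) by blast
      then obtain r where r: "r > 0" "ball (x, y) r \<subseteq> T" using T(1) open_contains_ball by blast
      obtain a' b' c' d' where R: "a \<le> a'" "a' < b'" "b' \<le> b" "c \<le> c'" "c' < d'" "d' \<le> d"
        "x \<in> {a'..b'}" "y \<in> {c'..d'}" "b' - a' < r / 2" "d' - c' < r / 2" "\<not> P a' b' c' d'"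
        "(b' - a') * (d - c) = (d' - c') * (b - a)"
        using xy[OF half_gt_zero[OF r(1)]] by blast
      have "{a'..b'} \<times> {c'..d'} \<subseteq> T"
      proof
        fix p assume p: "p \<in> {a'..b'} \<times> {c'..d'}"
        have "dist (x, y) p \<le> dist x (fst p) + dist y (snd p)"
          unfolding dist_prod_def by (simp add: sqrt_sum_squares_le_sum)
        also have "\<dots> < r" using p R by (auto simp: dist_real_def)
        finally show "p \<in> T" using r(2) by auto
      qed
      then have eq: "{a'..b'} \<times> {c'..d'} \<inter> (T - ?E) = {a'..b'} \<times> {c'..d'} - ?E" by blast
      show False using bnd[OF R(1-6,12)] R(11) unfolding P_def \<mu>_def eq by blast
    qed
  qed
  moreover have "\<mu> a b c d \<le> e"
  proof -
    have 1: "{a..b} \<times> {c..d} \<inter> (T - ?E) \<subseteq> T - ?S" by (auto simp: cplx_def in_cbox_complex_iff)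
    have 2: "{a..b} \<times> {c..d} \<inter> (T - ?E) \<in> sets lborel"
      using sets.Int[OF borel_closed[OF closed_Times[OF closed_atLeastAtMost closed_atLeastAtMost]] TE] by simp
    have "measure lebesgue ({a..b} \<times> {c..d} \<inter> (T - ?E)) \<le> measure lebesgue (T - ?S)"
      using sets_completionI_sets[OF 2] by (rule measure_mono_fmeasurable[OF 1 _ T(3)])
    moreover have "measure lebesgue ({a..b} \<times> {c..d} \<inter> (T - ?E)) = \<mu> a b c d"
      unfolding \<mu>_def by (rule measure_completion[OF 2])
    ultimately show ?thesis using mT by linarith
  qed
  ultimately have "norm (rect_integral f a b c d) \<le> C * e"
    using C unfolding P_def by (meson mult_left_mono order_trans)
  also have "\<dots> < (C + 1) * e" using e by simp
  also have "\<dots> = norm (rect_integral f a b c d)" using C by (simp add: e_def)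
  finally show False by simp
qed

section \<open>The Looman-Menchoff theorem\<close>

text \<open>Morera's theorem on a box. \<open>G\<close> integrates along the bottom and then
  upwards; vanishing rectangle integrals make the other route equal (\<open>G2\<close>). Each route
  exhibits one partial derivative, \<open>f\<close> in \<open>x\<close> and \<open>\<i> * f\<close>
  in \<open>y\<close>. As \<open>f\<close> is continuous, \<open>G\<close> is complex
  differentiable, and \<open>f\<close> is holomorphic as the derivative of \<open>G\<close>.\<close>

lemma holomorphic_on_box_if_rect_integral_eq_0:
  assumes cont: "continuous_on (rect a b c d) f" and ab: "a < b" "c < d"
    and zero: "\<And>a' b' c' d'. a \<le> a' \<Longrightarrow> a' < b' \<Longrightarrow> b' \<le> b \<Longrightarrow> c \<le> c' \<Longrightarrow> c' < d' \<Longrightarrow> d' \<le> d \<Longrightarrow> rect_integral f a' b' c' d' = 0"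
  shows "f holomorphic_on box (Complex a c) (Complex b d)"
proof -
  define G where "G x y = integral {a..x} (\<lambda>t. f (Complex t c)) + \<i> * integral {c..y} (\<lambda>s. f (Complex x s))" for x y
  have G2: "G x y = integral {a..x} (\<lambda>t. f (Complex t y)) + \<i> * integral {c..y} (\<lambda>s. f (Complex a s))"
    if "x \<in> {a<..<b}" "y \<in> {c<..<d}" for x y
    using zero[of a x c y] that by (simp add: rect_integral_def G_def algebra_simps)
  have Gx: "((\<lambda>x. G x y) has_derivative (\<lambda>h. h *\<^sub>R f (Complex x y))) (at x within {a<..<b})"
    if x: "x \<in> {a<..<b}" and y: "y \<in> {c<..<d}" for x y
  proof -
    have "((\<lambda>u. integral {a..u} (\<lambda>t. f (Complex t y))) has_vector_derivative f (Complex x y)) (at x within {a..b})"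
      by (rule integral_has_vector_derivative) (use x y in \<open>auto intro!: continuous_on_horizontal[OF cont]\<close>)
    then have "((\<lambda>u. integral {a..u} (\<lambda>t. f (Complex t y)) + \<i> * integral {c..y} (\<lambda>s. f (Complex a s))) has_vector_derivative f (Complex x y)) (at x within {a<..<b})"
      by (auto intro!: derivative_eq_intros elim!: has_vector_derivative_within_subset)
    then show ?thesis unfolding has_vector_derivative_def
      by (rule has_derivative_transform[rotated 2]) (use x y G2 in auto)
  qed
  have Gy: "((\<lambda>y. G x y) has_derivative blinfun_apply (blinfun_scaleR_left (\<i> * f (Complex x y)))) (at y within {c<..<d})"
    if x: "x \<in> {a<..<b}" and y: "y \<in> {c<..<d}" for x y
  proof -
    have "((\<lambda>u. integral {c..u} (\<lambda>s. f (Complex x s))) has_vector_derivative f (Complex x y)) (at y within {c..d})"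
      by (rule integral_has_vector_derivative) (use x y in \<open>auto intro!: continuous_on_vertical[OF cont]\<close>)
    then have "((\<lambda>y. G x y) has_vector_derivative \<i> * f (Complex x y)) (at y within {c<..<d})"
      unfolding G_def
      by (auto intro!: derivative_eq_intros has_vector_derivative_mult_right elim!: has_vector_derivative_within_subset)
    then show ?thesis unfolding has_vector_derivative_def by simp
  qed
  have main: "((\<lambda>z. G (Re z) (Im z)) has_field_derivative f z) (at z)"
    if z: "z \<in> box (Complex a c) (Complex b d)" for z
  proof -
    define x y where "x = Re z" and "y = Im z"
    have x: "x \<in> {a<..<b}" and y: "y \<in> {c<..<d}" using z by (auto simp: in_box_complex_iff x_def y_def)
    have "((\<lambda>(x, y). G x y) has_derivative (\<lambda>(tx, ty). tx *\<^sub>R f (Complex x y) + blinfun_scaleR_left (\<i> * f (Complex x y)) ty))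
        (at (x, y) within {a<..<b} \<times> {c<..<d})"
    proof (rule has_derivative_partialsI[OF Gx[OF x y] Gy])
      have "continuous_on ({a<..<b} \<times> {c<..<d}) (\<lambda>p. f (Complex (fst p) (snd p)))"
        unfolding Complex_eq
        by (intro continuous_on_compose2[OF cont] continuous_intros) (auto simp: in_cbox_complex_iff)
      then have "continuous (at (x, y) within {a<..<b} \<times> {c<..<d}) (\<lambda>p. f (Complex (fst p) (snd p)))"
        using x y by (auto simp: continuous_on_eq_continuous_within)
      then show "continuous (at (x, y) within {a<..<b} \<times> {c<..<d}) (\<lambda>(x, y). blinfun_scaleR_left (\<i> * f (Complex x y)))"
        unfolding case_prod_unfold
        by (intro continuous_intros bounded_linear.continuous[OF bounded_linear_blinfun_scaleR_left])
    qed (use y in auto)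
    then have "((\<lambda>(x, y). G x y) has_derivative (\<lambda>(tx, ty). tx *\<^sub>R f (Complex x y) + ty *\<^sub>R (\<i> * f (Complex x y)))) (at (x, y))"
      using x y by (subst (asm) at_within_open) (auto intro: open_Times)
    moreover have "((\<lambda>z. (Re z, Im z)) has_derivative (\<lambda>z. (Re z, Im z))) (at z)"
      by (auto intro!: derivative_eq_intros)
    ultimately have "((\<lambda>(x, y). G x y) \<circ> (\<lambda>z. (Re z, Im z)) has_derivative
        (\<lambda>(tx, ty). tx *\<^sub>R f (Complex x y) + ty *\<^sub>R (\<i> * f (Complex x y))) \<circ> (\<lambda>z. (Re z, Im z))) (at z)"
      by (intro diff_chain_at) (auto simp: x_def y_def)
    moreover have "(\<lambda>(tx, ty). tx *\<^sub>R f (Complex x y) + ty *\<^sub>R (\<i> * f (Complex x y))) \<circ> (\<lambda>z. (Re z, Im z)) = (*) (f z)"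
      by (auto simp: fun_eq_iff x_def y_def complex_eq_iff algebra_simps)
    ultimately show ?thesis by (simp add: has_field_derivative_def o_def)
  qed
  let ?B = "box (Complex a c) (Complex b d)"
  have "(\<lambda>z. G (Re z) (Im z)) holomorphic_on ?B"
    unfolding holomorphic_on_open[OF open_box] using main by blast
  then have "deriv (\<lambda>z. G (Re z) (Im z)) holomorphic_on ?B" by (intro holomorphic_deriv) auto
  then show ?thesis
    by (rule holomorphic_transform) (use main DERIV_imp_deriv in blast)
qed

lemma eventually_norm_increment_le:
  fixes g :: "real \<Rightarrow> 'a::real_normed_vector"
  assumes "(g has_vector_derivative D) (at 0)"
  obtains d where "d > 0" "\<And>t. \<bar>t\<bar> < d \<Longrightarrow> norm (g t - g 0) \<le> (norm D + 1) * \<bar>t\<bar>"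
proof -
  have "((\<lambda>h. norm ((g h - g 0) /\<^sub>R h)) \<longlongrightarrow> norm D) (at 0)"
    by (intro tendsto_norm has_vector_derivative_at_0_quotient assms)
  then have "\<forall>\<^sub>F h in at 0. norm ((g h - g 0) /\<^sub>R h) < norm D + 1"
    by (rule order_tendstoD) simp
  then obtain d where d: "d > 0" "\<And>t. t \<noteq> 0 \<Longrightarrow> \<bar>t\<bar> < d \<Longrightarrow> norm ((g t - g 0) /\<^sub>R t) < norm D + 1"
    by (auto simp: eventually_at)
  show ?thesis
  proof (rule that[OF d(1)])
    fix t :: real assume t: "\<bar>t\<bar> < d"
    show "norm (g t - g 0) \<le> (norm D + 1) * \<bar>t\<bar>"
    proof (cases "t = 0")
      case False
      have "norm ((g t - g 0) /\<^sub>R t) = norm (g t - g 0) / \<bar>t\<bar>" by (simp add: divide_inverse mult.commute)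
      then show ?thesis using d(2)[OF False t] False by (simp add: pos_divide_less_eq)
    qed simp
  qed
qed

text \<open>By the Baire category theorem the difference quotients of \<open>f\<close> along the axes are uniformly bounded
  on a nonempty relatively open part of the set of points near which \<open>f\<close> is not holomorphic.\<close>

theorem looman_menchoff:
  fixes f :: "complex \<Rightarrow> complex"
  assumes U: "open U" and cont: "continuous_on U f"
    and CR: "\<And>z. z \<in> U \<Longrightarrow> \<exists>Dx Dy. ((\<lambda>t. f (z + of_real t)) has_vector_derivative Dx) (at 0) \<and>
        ((\<lambda>t. f (z + \<i> * of_real t)) has_vector_derivative Dy) (at 0) \<and> Dx + \<i> * Dy = 0"
  shows "f holomorphic_on U"
proof -
  obtain fx fy where dx: "\<And>z. z \<in> U \<Longrightarrow> ((\<lambda>t. f (z + of_real t)) has_vector_derivative fx z) (at 0)"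
    and dy: "\<And>z. z \<in> U \<Longrightarrow> ((\<lambda>t. f (z + \<i> * of_real t)) has_vector_derivative fy z) (at 0)"
    and CR': "\<And>z. z \<in> U \<Longrightarrow> fx z + \<i> * fy z = 0"
    using CR by metis
  \<comment> \<open>The largest open subset of \<open>U\<close> on which \<open>f\<close> is
    holomorphic; \<open>U - D\<close> is the bad set.\<close>
  define D where "D = \<Union>{V. open V \<and> V \<subseteq> U \<and> f holomorphic_on V}"
  have D: "open D" "D \<subseteq> U" unfolding D_def by auto
  have hol: "f holomorphic_on D"
  proof -
    have "\<exists>f'. (f has_field_derivative f') (at z)" if "z \<in> D" for z
      using that unfolding D_def by (auto simp: holomorphic_on_open)
    then show ?thesis using D(1) by (simp add: holomorphic_on_open)
  qed
  have "U - D = {}"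
  proof (rule ccontr)
    assume "U - D \<noteq> {}"
    then obtain z0 where z0: "z0 \<in> U" "z0 \<notin> D" by auto
    obtain R where R: "R > 0" "cball z0 R \<subseteq> U" using U z0 open_contains_cball by blast
    define r where "r = R / 2"
    have r: "r > 0" "cball z0 (2 * r) \<subseteq> U" using R by (auto simp: r_def)
    \<comment> \<open>Baire's theorem is applied to a closed set, hence the closure. Since
      \<open>cball z0 (2 * r)\<close> lies in \<open>U\<close>, shifts by
      \<open>\<bar>t\<bar> \<le> r\<close> do not leave \<open>U\<close>.\<close>
    define X where "X = closure ((U - D) \<inter> ball z0 r)"
    have "X \<subseteq> cball z0 r - D"
      unfolding X_def using D by (intro closure_minimal closed_Diff) auto
    moreover have "cball z0 r \<subseteq> U" using r by (auto simp: subset_eq)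
    ultimately have XU: "X \<subseteq> U" and XD: "X \<inter> D = {}" and Xr: "X \<subseteq> cball z0 r" by auto
    have z0X: "z0 \<in> X" unfolding X_def using z0 r(1) closure_subset by fastforce
    have shift: "z + v * of_real t \<in> U" if "z \<in> X" "norm v = 1" "\<bar>t\<bar> \<le> r" for z v and t :: real
    proof -
      have "dist z0 (z + v * of_real t) \<le> dist z0 z + norm (v * of_real t)"
        by (metis add_diff_cancel_left' dist_norm dist_triangle norm_minus_commute)
      also have "\<dots> \<le> 2 * r" using that Xr by (auto simp: norm_mult)
      finally show ?thesis using r(2) by auto
    qed
    define B where "B n t v = {z \<in> X. norm (f (z + v * of_real t) - f z) \<le> real (Suc n) * \<bar>t\<bar>}" for n t v
    \<comment> \<open>Increments along both axes are bounded with constant \<open>Suc n\<close> for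
      steps up to \<open>r / Suc n\<close>. These sets are closed by continuity of \<open>f\<close>,
      and they cover \<open>X\<close> because both partial derivatives exist.\<close>
    define A where "A n = (\<Inter>t\<in>{t. \<bar>t\<bar> \<le> r / real (Suc n)}. B n t 1 \<inter> B n t \<i>)" for n
    have tr: "\<bar>t\<bar> \<le> r" if "\<bar>t\<bar> \<le> r / real (Suc n)" for t n
    proof -
      have "r / real (Suc n) \<le> r / 1" using r(1) by (intro divide_left_mono) auto
      then show ?thesis using that by simp
    qed
    have "closed (B n t v)" if "\<bar>t\<bar> \<le> r / real (Suc n)" "norm v = 1" for n t v
      unfolding B_def
    proof (rule continuous_on_closed_Collect_le)
      show "continuous_on X (\<lambda>z. norm (f (z + v * of_real t) - f z))"
        by (intro continuous_intros continuous_on_compose2[OF cont])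
           (use XU shift that tr in auto)
    qed (auto simp: X_def)
    then have Acl: "closed (A n)" for n unfolding A_def by (intro closed_INT ballI closed_Int) auto
    have cover: "\<exists>n. z \<in> A n" if z: "z \<in> X" for z
    proof -
      have zU: "z \<in> U" using z XU by auto
      obtain d1 where d1: "d1 > 0" "\<And>t. \<bar>t\<bar> < d1 \<Longrightarrow> norm (f (z + of_real t) - f z) \<le> (norm (fx z) + 1) * \<bar>t\<bar>"
        using eventually_norm_increment_le[OF dx[OF zU]] by auto
      obtain d2 where d2: "d2 > 0" "\<And>t. \<bar>t\<bar> < d2 \<Longrightarrow> norm (f (z + \<i> * of_real t) - f z) \<le> (norm (fy z) + 1) * \<bar>t\<bar>"
        using eventually_norm_increment_le[OF dy[OF zU]] by auto
      obtain n where n: "real n > max (norm (fx z) + 1) (max (norm (fy z) + 1) (max (r / d1) (r / d2)))"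
        using reals_Archimedean2 by blast
      have "r / real (Suc n) < d1" "r / real (Suc n) < d2"
        using n d1(1) d2(1) r(1) by (auto simp: field_simps)
      moreover have "norm (fx z) + 1 \<le> real (Suc n)" "norm (fy z) + 1 \<le> real (Suc n)" using n by auto
      ultimately have "z \<in> B n t 1 \<inter> B n t \<i>" if "\<bar>t\<bar> \<le> r / real (Suc n)" for t
        using z that d1(2)[of t] d2(2)[of t] mult_right_mono[of "norm (fx z) + 1" "real (Suc n)" "\<bar>t\<bar>"]
          mult_right_mono[of "norm (fy z) + 1" "real (Suc n)" "\<bar>t\<bar>"]
        by (simp add: B_def del: of_nat_Suc)
      then show ?thesis unfolding A_def by blast
    qed
    \<comment> \<open>Otherwise every \<open>X - A n\<close> is open and dense in \<open>X\<close>,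
      so their intersection is dense as well, although it is empty.\<close>
    obtain n where n: "\<not> X \<subseteq> closure (X - A n)"
    proof (rule ccontr)
      assume "\<not> thesis"
      then have dense: "X \<subseteq> closure (X - A n)" for n using that by blast
      have "X \<subseteq> closure (\<Inter>(range (\<lambda>n. X - A n)))"
      proof (rule Baire)
        show "closed X" by (simp add: X_def)
        fix T assume "T \<in> range (\<lambda>n. X - A n)"
        then obtain k where T: "T = X - A k" by auto
        have "openin (top_of_set X) T"
          unfolding openin_open T using Acl[of k] by (intro exI[of _ "- A k"]) auto
        then show "openin (top_of_set X) T \<and> X \<subseteq> closure T" using dense T by blast
      qed auto
      moreover have "\<Inter>(range (\<lambda>n. X - A n)) = {}" using cover by blast
      ultimately have "X \<subseteq> closure {}" by (simp only:)
      then show False using z0X by simp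
    qed
    then obtain w0 where w0: "w0 \<in> X" "w0 \<notin> closure (X - A n)" by blast
    define V where "V = - closure (X - A n)"
    have V: "open V" "w0 \<in> V" "V \<inter> X \<subseteq> A n"
      using w0 closure_subset[of "X - A n"] by (auto simp: V_def)
    \<comment> \<open>\<open>w0\<close> is only known to lie in the closure \<open>X\<close>; since
      \<open>V\<close> is open, it also contains a genuine point of the bad set.\<close>
    obtain w where w: "w \<in> V" "w \<in> U - D" "w \<in> ball z0 r"
      using w0(1) V(2) open_Int_closure_eq_empty[OF V(1), of "(U - D) \<inter> ball z0 r"] unfolding X_def by blast
    have "open (V \<inter> ball z0 r)" using V by auto
    then obtain s0 where s0: "s0 > 0" "ball w s0 \<subseteq> V \<inter> ball z0 r" using w open_contains_ball by blast
    \<comment> \<open>Any two points of \<open>ball w s\<close> differ by less than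
      \<open>2 * s\<close>, an admissible step for \<open>A n\<close>.\<close>
    define s where "s = min s0 (r / real (Suc n) / 2)"
    have s1: "s \<le> s0" "s \<le> r / real (Suc n) / 2" by (simp_all only: s_def min.cobounded1 min.cobounded2)
    have "s > 0" using s0(1) r(1) by (simp add: s_def)
    moreover have "ball w s \<subseteq> V \<inter> ball z0 r" using s0(2) subset_ball[OF s1(1)] by blast
    moreover have "2 * s \<le> r / real (Suc n)" using s1(2) by (simp only: le_divide_eq_numeral1 mult.commute)
    ultimately have s: "s > 0" "ball w s \<subseteq> V \<inter> ball z0 r" "2 * s \<le> r / real (Suc n)" by blast+
    let ?U = "ball w s"
    have UU: "?U \<subseteq> U" using s(2) \<open>cball z0 r \<subseteq> U\<close> ball_subset_cball[of z0 r] by blast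
    have lip: "norm (f w' - f z) \<le> real (Suc n) * norm (w' - z)"
      if z: "z \<in> ?U - D \<inter> ?U" and w': "w' \<in> ?U" and line: "Re w' = Re z \<or> Im w' = Im z" for z w'
    proof -
      have "z \<in> (U - D) \<inter> ball z0 r" using z s(2) UU by auto
      then have "z \<in> X" unfolding X_def by (rule subsetD[OF closure_subset])
      moreover have "z \<in> V" using z s(2) by blast
      ultimately have zA: "z \<in> A n" using V(3) by blast
      have "norm (w' - z) < 2 * s"
        using z w' norm_triangle_ineq4[of "w' - w" "z - w"] by (auto simp: dist_norm norm_minus_commute)
      then have small: "norm (w' - z) \<le> r / real (Suc n)" using s(3) by simp
      show ?thesis
      proof (cases "Im w' = Im z")
        case True
        define t where "t = Re w' - Re z"
        have eq: "w' = z + 1 * of_real t" using True by (simp add: t_def complex_eq_iff)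
        then have "norm (w' - z) = \<bar>t\<bar>" by simp
        then show ?thesis using zA small unfolding A_def B_def eq by auto
      next
        case False
        define t where "t = Im w' - Im z"
        have eq: "w' = z + \<i> * of_real t" using False line by (simp add: t_def complex_eq_iff)
        then have "norm (w' - z) = \<bar>t\<bar>" by (simp add: norm_mult)
        then show ?thesis using zA small unfolding A_def B_def eq by auto
      qed
    qed
    \<comment> \<open>Half side \<open>s / 3\<close>: the sum of the coordinate distances to the
      centre is at most \<open>2 * s / 3\<close>, so the square fits into the ball.\<close>
    define a b c d where "a = Re w - s / 3" and "b = Re w + s / 3" and "c = Im w - s / 3" and "d = Im w + s / 3"
    have sub: "rect a b c d \<subseteq> ?U"
    proof
      fix z assume z: "z \<in> rect a b c d"
      have "norm (w - z) \<le> \<bar>Re (w - z)\<bar> + \<bar>Im (w - z)\<bar>" by (rule cmod_le)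
      also have "\<dots> < s" using z s(1) by (auto simp: in_cbox_complex_iff a_def b_def c_def d_def)
      finally show "z \<in> ?U" by (simp add: dist_norm)
    qed
    have "f holomorphic_on box (Complex a c) (Complex b d)"
    proof (rule holomorphic_on_box_if_rect_integral_eq_0)
      show "continuous_on (rect a b c d) f" using continuous_on_subset[OF cont] sub UU by blast
      show "a < b" "c < d" using s(1) by (auto simp: a_def b_def c_def d_def)
      fix a' b' c' d' assume le: "a \<le> a'" "a' < b'" "b' \<le> b" "c \<le> c'" "c' < d'" "d' \<le> d"
      have "rect a' b' c' d' \<subseteq> rect a b c d" using le by (auto simp: in_cbox_complex_iff)
      then have sub': "rect a' b' c' d' \<subseteq> ?U" using sub by blast
      show "rect_integral f a' b' c' d' = 0"
      proof (rule rect_integral_eq_0_if_lipschitz_from[where U = ?U and D = "D \<inter> ?U" and N = "real (Suc n)" and fx = fx and fy = fy])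
        show "f holomorphic_on D \<inter> ?U" by (rule holomorphic_on_subset[OF hol]) auto
        show "continuous_on ?U f" by (rule continuous_on_subset[OF cont UU])
      qed (use D(1) le sub' lip dx dy CR' UU in auto)
    qed
    moreover have "box (Complex a c) (Complex b d) \<subseteq> U"
      using sub UU box_subset_cbox[of "Complex a c" "Complex b d"] by blast
    \<comment> \<open>The box is among the sets united in \<open>D\<close>, yet its centre
      \<open>w\<close> is bad.\<close>
    ultimately have "box (Complex a c) (Complex b d) \<subseteq> D" unfolding D_def by blast
    moreover have "w \<in> box (Complex a c) (Complex b d)"
      using s(1) by (auto simp: in_box_complex_iff a_def b_def c_def d_def)
    ultimately show False using w(2) by auto
  qed
  then show ?thesis using hol D(2) by (metis Diff_eq_empty_iff subset_antisym)
qed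

section \<open>Phragmen-Lindelof in a strip\<close>

text \<open>The growth is beaten by the factor \<open>exp (- (\<delta> * T w))\<close>, where
  \<open>T w\<close> is \<open>2 * cosh (\<gamma> * (w - \<i> * m))\<close> with \<gamma> strictly
  between \<beta> and \<open>pi / (q - p)\<close>. The maximum principle on long rectangles bounds
  the damped function, and \<delta> tends to 0.\<close>

theorem phragmen_lindelof_strip:
  fixes H :: "complex \<Rightarrow> complex"
  assumes pq: "p < q" and \<beta>: "\<beta> \<ge> 0" "\<beta> * (q - p) < pi" and "C \<ge> 0"
    and cont: "continuous_on {w. p \<le> Im w \<and> Im w \<le> q} H"
    and hol: "H holomorphic_on {w. p < Im w \<and> Im w < q}"
    and edges: "\<And>w. Im w = p \<or> Im w = q \<Longrightarrow> norm (H w) \<le> M"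
    and growth: "\<And>w. p \<le> Im w \<Longrightarrow> Im w \<le> q \<Longrightarrow> norm (H w) \<le> C * exp (A * exp (\<beta> * \<bar>Re w\<bar>))"
    and w0: "p \<le> Im w0" "Im w0 \<le> q"
  shows "norm (H w0) \<le> M"
proof -
  define \<gamma> where "\<gamma> = (\<beta> + pi / (q - p)) / 2"
  have "\<beta> < pi / (q - p)" using pq \<beta> by (simp add: field_simps)
  moreover have "x < (x + y) / 2" "(x + y) / 2 < y" if "x < y" for x y :: real using that by auto
  ultimately have \<gamma>: "\<beta> < \<gamma>" "\<gamma> < pi / (q - p)" unfolding \<gamma>_def by blast+
  then have \<gamma>': "\<gamma> > 0" "\<gamma> * (q - p) < pi" using pq \<beta> by (auto simp: field_simps)
  define m where "m = (p + q) / 2"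
  \<comment> \<open>Lower bound of the cosine factor of \<open>Re (T w)\<close> on the strip;
    centring at \<open>m\<close> keeps its argument below \<open>pi / 2\<close> in absolute
    value.\<close>
  define \<kappa> where "\<kappa> = cos (\<gamma> * ((q - p) / 2))"
  have "0 < \<gamma> * (q - p)" using \<gamma>' pq by simp
  then have half: "0 < \<gamma> * ((q - p) / 2)" "\<gamma> * ((q - p) / 2) < pi / 2" using \<gamma>'(2) by auto
  have \<kappa>: "\<kappa> > 0" unfolding \<kappa>_def by (rule cos_gt_zero_pi) (use half pi_gt_zero in linarith)+
  have M: "M \<ge> 0" by (rule order_trans[OF norm_ge_zero edges[of "Complex 0 p"]]) simp
  define T where "T w = exp (of_real \<gamma> * (w - \<i> * of_real m)) + exp (- (of_real \<gamma> * (w - \<i> * of_real m)))" for w :: complex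
  have ReT: "Re (T w) = (exp (\<gamma> * Re w) + exp (- (\<gamma> * Re w))) * cos (\<gamma> * (Im w - m))" for w
    by (simp add: T_def Re_exp algebra_simps) (metis cos_minus minus_diff_eq)
  have Tge: "\<kappa> * exp (\<gamma> * \<bar>Re w\<bar>) \<le> Re (T w)" if "p \<le> Im w" "Im w \<le> q" for w
  proof -
    have "\<bar>Im w - m\<bar> \<le> (q - p) / 2"
      using that unfolding m_def abs_le_iff by (auto simp: field_simps)
    then have "\<bar>\<gamma> * (Im w - m)\<bar> \<le> \<gamma> * ((q - p) / 2)"
      unfolding abs_mult using \<gamma>' by (intro mult_mono) auto
    then have "\<kappa> \<le> cos \<bar>\<gamma> * (Im w - m)\<bar>" unfolding \<kappa>_def
      using half pi_gt_zero by (intro cos_monotone_0_pi_le) linarith+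
    then have "\<kappa> \<le> cos (\<gamma> * (Im w - m))" by simp
    moreover have "exp (\<gamma> * \<bar>Re w\<bar>) \<le> exp (\<gamma> * Re w) + exp (- (\<gamma> * Re w))"
      by (auto simp: abs_if)
    ultimately have "exp (\<gamma> * \<bar>Re w\<bar>) * \<kappa> \<le> Re (T w)" unfolding ReT
      using \<kappa> by (intro mult_mono) (auto simp: add_nonneg_nonneg)
    then show ?thesis by (simp add: mult.commute)
  qed
  have damped: "norm (H w0) * exp (- (\<delta> * Re (T w0))) \<le> M" if \<delta>: "\<delta> > 0" for \<delta>
  proof (rule field_le_epsilon)
    fix \<eta> :: real assume \<eta>: "\<eta> > 0"
    define G where "G w = H w * exp (- (of_real \<delta> * T w))" for w
    have nG: "norm (G w) = norm (H w) * exp (- (\<delta> * Re (T w)))" for w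
      by (simp add: G_def norm_mult)
    \<comment> \<open>Makes \<open>C * exp (- L) \<le> \<eta>\<close> on the short sides.
      \<open>C + 1\<close> keeps the logarithm meaningful for \<open>C = 0\<close>, and
      \<open>max 0\<close> yields \<open>L \<le> L * exp (\<beta> * S)\<close>.\<close>
    define L where "L = max 0 (ln ((C + 1) / \<eta>))"
    obtain S0 where S0: "\<And>s. s \<ge> S0 \<Longrightarrow> A + L \<le> \<delta> * \<kappa> * exp ((\<gamma> - \<beta>) * s)"
    proof -
      have "filterlim (\<lambda>s. (\<gamma> - \<beta>) * s) at_top at_top"
        using \<gamma> by (intro filterlim_tendsto_pos_mult_at_top[OF tendsto_const]) (auto simp: filterlim_ident)
      then have "filterlim (\<lambda>s. exp ((\<gamma> - \<beta>) * s)) at_top at_top"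
        by (rule filterlim_compose[OF exp_at_top])
      then have "filterlim (\<lambda>s. \<delta> * \<kappa> * exp ((\<gamma> - \<beta>) * s)) at_top at_top"
        using \<delta> \<kappa> by (intro filterlim_tendsto_pos_mult_at_top[OF tendsto_const]) auto
      then show ?thesis using that unfolding filterlim_at_top eventually_at_top_linorder by blast
    qed
    define S where "S = max (max S0 0) \<bar>Re w0\<bar> + 1"
    have S: "S \<ge> S0" "S > \<bar>Re w0\<bar>" "S > 0" by (auto simp: S_def)
    have side: "norm (G w) \<le> \<eta>" if w: "p \<le> Im w" "Im w \<le> q" "\<bar>Re w\<bar> = S" for w
    proof -
      have "L \<le> L * exp (\<beta> * S)" using S \<beta> by (simp add: L_def mult_le_cancel_left1)
      also have "\<dots> \<le> (\<delta> * \<kappa> * exp ((\<gamma> - \<beta>) * S) - A) * exp (\<beta> * S)"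
        using S0[OF S(1)] by (intro mult_right_mono) auto
      also have "\<dots> = \<delta> * \<kappa> * exp (\<gamma> * S) - A * exp (\<beta> * S)"
        by (simp add: algebra_simps flip: exp_add)
      finally have L: "A * exp (\<beta> * S) - \<delta> * \<kappa> * exp (\<gamma> * S) \<le> - L" by simp
      have "norm (G w) \<le> (C * exp (A * exp (\<beta> * S))) * exp (- (\<delta> * (\<kappa> * exp (\<gamma> * S))))"
        unfolding nG using growth[OF w(1,2)] Tge[OF w(1,2)] \<delta> \<open>C \<ge> 0\<close> unfolding w(3)
        by (intro mult_mono) auto
      also have "\<dots> = C * exp (A * exp (\<beta> * S) - \<delta> * \<kappa> * exp (\<gamma> * S))"
        by (simp add: mult.assoc flip: exp_add)
      also have "\<dots> \<le> C * exp (- L)" using L \<open>C \<ge> 0\<close> by (intro mult_left_mono) auto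
      also have "\<dots> \<le> C * exp (- ln ((C + 1) / \<eta>))"
        using \<open>C \<ge> 0\<close> by (intro mult_left_mono) (auto simp: L_def)
      also have "\<dots> = C / (C + 1) * \<eta>" using \<open>C \<ge> 0\<close> \<eta> by (simp add: exp_minus)
      also have "\<dots> \<le> 1 * \<eta>" using \<open>C \<ge> 0\<close> \<eta> by (intro mult_right_mono) auto
      finally show ?thesis by simp
    qed
    let ?R = "cbox (Complex (- S) p) (Complex S q)"
    have "norm (G w0) \<le> M + \<eta>"
    proof (rule maximum_modulus_frontier[of G ?R])
      have "G holomorphic_on {w. p < Im w \<and> Im w < q}"
        unfolding G_def T_def by (intro holomorphic_intros hol)
      then show "G holomorphic_on interior ?R"
        by (rule holomorphic_on_subset) (auto simp: interior_cbox in_box_complex_iff)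
      have "continuous_on {w. p \<le> Im w \<and> Im w \<le> q} G"
        unfolding G_def T_def by (intro continuous_intros cont)
      then show "continuous_on (closure ?R) G"
        by (rule continuous_on_subset) (auto simp: in_cbox_complex_iff)
      show "w0 \<in> ?R" using w0 S by (auto simp: in_cbox_complex_iff)
      fix w assume "w \<in> frontier ?R"
      then have w: "p \<le> Im w" "Im w \<le> q" and bd: "\<bar>Re w\<bar> = S \<or> Im w = p \<or> Im w = q"
        by (auto simp: frontier_cbox in_cbox_complex_iff in_box_complex_iff)
      have "norm (G w) \<le> M" if "Im w = p \<or> Im w = q"
      proof -
        have "0 \<le> \<delta> * Re (T w)" using \<delta> Tge[OF w] \<kappa> by (intro mult_nonneg_nonneg) (auto intro: order_trans[rotated])
        then have "norm (G w) \<le> norm (H w) * 1" unfolding nG by (intro mult_left_mono) auto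
        then show ?thesis using edges[OF that] by simp
      qed
      then show "norm (G w) \<le> M + \<eta>" using side[OF w] bd M \<eta> by fastforce
    qed auto
    then show "norm (H w0) * exp (- (\<delta> * Re (T w0))) \<le> M + \<eta>" by (simp add: nG)
  qed
  have "((\<lambda>\<delta>. norm (H w0) * exp (- (\<delta> * Re (T w0)))) \<longlongrightarrow> norm (H w0) * exp (- (0 * Re (T w0)))) (at_right 0)"
    by (intro tendsto_intros)
  then have "norm (H w0) * exp (- (0 * Re (T w0))) \<le> M"
    by (rule tendsto_upperbound) (use damped in \<open>auto simp: eventually_at_right_field intro: exI[of _ 1]\<close>)
  then show ?thesis by simp
qed

text \<open>\<open>\<rho> * \<phi> = pi\<close> is allowed here, while
  \<open>phragmen_lindelof_strip\<close> demands a strict inequality; a half strip satisfies it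
  because \<open>\<rho> * (\<phi> / 2) \<le> pi / 2\<close>. On the closed strip
  \<open>cos (\<rho> * Im w)\<close> is nonnegative, so the multiplier has modulus at most 1 and the
  bound on the edges survives.\<close>

theorem phragmen_lindelof_strip_type:
  fixes H :: "complex \<Rightarrow> complex"
  assumes \<phi>: "\<phi> > 0" and \<rho>: "\<rho> > 0" "\<rho> * \<phi> \<le> pi" and \<sigma>: "\<sigma> \<ge> 0"
    and cont: "continuous_on {w. - \<phi> / 2 \<le> Im w \<and> Im w \<le> \<phi> / 2} H"
    and hol: "H holomorphic_on {w. - \<phi> / 2 < Im w \<and> Im w < \<phi> / 2}"
    and edges: "\<And>w. \<bar>Im w\<bar> = \<phi> / 2 \<Longrightarrow> norm (H w) \<le> M"
    and growth: "\<And>\<epsilon>. \<epsilon> > 0 \<Longrightarrow> \<exists>C. \<forall>w. \<bar>Im w\<bar> \<le> \<phi> / 2 \<longrightarrow> norm (H w) \<le> C * exp ((\<sigma> + \<epsilon>) * exp (\<rho> * Re w))"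
    and w0: "\<bar>Im w0\<bar> \<le> \<phi> / 2"
  shows "norm (H w0) \<le> M * exp (\<sigma> * exp (\<rho> * Re w0) * cos (\<rho> * Im w0))"
proof -
  have M: "M \<ge> 0" by (rule order_trans[OF norm_ge_zero edges[of "Complex 0 (\<phi> / 2)"]]) (use \<phi> in simp)
  have cosge: "0 \<le> cos (\<rho> * Im w)" if "\<bar>Im w\<bar> \<le> \<phi> / 2" for w
  proof -
    have "\<bar>\<rho> * Im w\<bar> \<le> \<rho> * (\<phi> / 2)" using that \<rho> by (auto simp: abs_mult intro!: mult_left_mono)
    also have "\<dots> \<le> pi / 2" using \<rho> by simp
    finally show ?thesis by (intro cos_ge_zero) auto
  qed
  have eps: "norm (H w0) * exp (- ((\<sigma> + \<epsilon>) * (exp (\<rho> * Re w0) * cos (\<rho> * Im w0)))) \<le> M" if \<epsilon>: "\<epsilon> > 0" for \<epsilon>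
  proof -
    define \<tau> where "\<tau> = \<sigma> + \<epsilon>"
    have \<tau>: "\<tau> > 0" using \<sigma> \<epsilon> by (simp add: \<tau>_def)
    obtain C0 where C0: "\<And>w. \<bar>Im w\<bar> \<le> \<phi> / 2 \<Longrightarrow> norm (H w) \<le> C0 * exp (\<tau> * exp (\<rho> * Re w))"
      using growth[OF \<epsilon>] unfolding \<tau>_def by blast
    define C where "C = max C0 0"
    have C: "C \<ge> 0" "\<bar>Im w\<bar> \<le> \<phi> / 2 \<Longrightarrow> norm (H w) \<le> C * exp (\<tau> * exp (\<rho> * Re w))" for w
      using order_trans[OF C0 mult_right_mono[of C0 C]] by (auto simp: C_def)
    define G where "G w = H w * exp (- (of_real \<tau> * exp (of_real \<rho> * w)))" for w
    have nG: "norm (G w) = norm (H w) * exp (- (\<tau> * (exp (\<rho> * Re w) * cos (\<rho> * Im w))))" for w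
      by (simp add: G_def norm_mult Re_exp)
    have GH: "norm (G w) \<le> norm (H w)" if "\<bar>Im w\<bar> \<le> \<phi> / 2" for w
    proof -
      have "0 \<le> \<tau> * (exp (\<rho> * Re w) * cos (\<rho> * Im w))" using \<tau> cosge[OF that] by simp
      then have "norm (G w) \<le> norm (H w) * 1" unfolding nG by (intro mult_left_mono) auto
      then show ?thesis by simp
    qed
    \<comment> \<open>On the real axis the cosine is 1 and the multiplier cancels the growth
      exactly.\<close>
    have centre: "norm (G w) \<le> C" if "Im w = 0" for w
    proof -
      have "norm (G w) \<le> (C * exp (\<tau> * exp (\<rho> * Re w))) * exp (- (\<tau> * exp (\<rho> * Re w)))"
        unfolding nG using C(2)[of w] that \<phi> by (simp add: mult_right_mono)
      also have "\<dots> = C" by (simp add: mult.assoc flip: exp_add)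
      finally show ?thesis .
    qed
    have Ggrow: "norm (G w) \<le> C * exp (\<tau> * exp (\<rho> * \<bar>Re w\<bar>))" if w: "\<bar>Im w\<bar> \<le> \<phi> / 2" for w
    proof -
      have "norm (G w) \<le> C * exp (\<tau> * exp (\<rho> * Re w))" using GH[OF w] C(2)[OF w] by linarith
      also have "\<dots> \<le> C * exp (\<tau> * exp (\<rho> * \<bar>Re w\<bar>))"
        using C(1) \<tau> \<rho> by (intro mult_left_mono exp_le_cancel_iff[THEN iffD2]) auto
      finally show ?thesis .
    qed
    have contG: "continuous_on {w. - \<phi> / 2 \<le> Im w \<and> Im w \<le> \<phi> / 2} G"
      unfolding G_def by (intro continuous_intros cont)
    have holG: "G holomorphic_on {w. - \<phi> / 2 < Im w \<and> Im w < \<phi> / 2}"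
      unfolding G_def by (intro holomorphic_intros hol)
    have edgeG: "norm (G w) \<le> M" if "\<bar>Im w\<bar> = \<phi> / 2" for w
      using GH[of w] edges[OF that] that by simp
    have halfpi: "\<rho> * (\<phi> / 2) < pi" using \<rho> pi_gt_zero by linarith
    have bounded: "norm (G w) \<le> max M C" if w: "\<bar>Im w\<bar> \<le> \<phi> / 2" for w
    proof (cases "Im w \<ge> 0")
      case True
      show ?thesis
      proof (rule phragmen_lindelof_strip[of 0 "\<phi> / 2" \<rho> C G _ \<tau>])
        show "continuous_on {w. 0 \<le> Im w \<and> Im w \<le> \<phi> / 2} G"
          by (rule continuous_on_subset[OF contG]) (use \<phi> in auto)
        show "G holomorphic_on {w. 0 < Im w \<and> Im w < \<phi> / 2}"
          by (rule holomorphic_on_subset[OF holG]) (use \<phi> in auto)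
        show "norm (G w) \<le> max M C" if "Im w = 0 \<or> Im w = \<phi> / 2" for w
          using that centre[of w] edgeG[of w] \<phi> by auto
      qed (use \<phi> \<rho> C Ggrow halfpi w True in auto)
    next
      case False
      show ?thesis
      proof (rule phragmen_lindelof_strip[of "- \<phi> / 2" 0 \<rho> C G _ \<tau>])
        show "continuous_on {w. - \<phi> / 2 \<le> Im w \<and> Im w \<le> 0} G"
          by (rule continuous_on_subset[OF contG]) (use \<phi> in auto)
        show "G holomorphic_on {w. - \<phi> / 2 < Im w \<and> Im w < 0}"
          by (rule holomorphic_on_subset[OF holG]) (use \<phi> in auto)
        show "norm (G w) \<le> max M C" if "Im w = - \<phi> / 2 \<or> Im w = 0" for w
          using that centre[of w] edgeG[of w] \<phi> by auto
      qed (use \<phi> \<rho> C Ggrow halfpi w False in auto)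
    qed
    \<comment> \<open>For a bounded function \<beta> = 0 and \<open>A = 0\<close> are admissible, so
      the full width of the strip is no obstacle.\<close>
    have "norm (G w0) \<le> M"
    proof (rule phragmen_lindelof_strip[of "- \<phi> / 2" "\<phi> / 2" 0 "max M C" G M 0])
      show "norm (G w) \<le> M" if "Im w = - \<phi> / 2 \<or> Im w = \<phi> / 2" for w
        using that edgeG[of w] \<phi> by auto
      show "norm (G w) \<le> max M C * exp (0 * exp (0 * \<bar>Re w\<bar>))" if "- \<phi> / 2 \<le> Im w" "Im w \<le> \<phi> / 2" for w
        using bounded[of w] that by simp
    qed (use \<phi> contG holG M w0 in auto)
    then show ?thesis by (simp add: nG \<tau>_def)
  qed
  have "((\<lambda>\<epsilon>. norm (H w0) * exp (- ((\<sigma> + \<epsilon>) * (exp (\<rho> * Re w0) * cos (\<rho> * Im w0)))))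
      \<longlongrightarrow> norm (H w0) * exp (- ((\<sigma> + 0) * (exp (\<rho> * Re w0) * cos (\<rho> * Im w0))))) (at_right 0)"
    by (intro tendsto_intros)
  then have "norm (H w0) * exp (- ((\<sigma> + 0) * (exp (\<rho> * Re w0) * cos (\<rho> * Im w0)))) \<le> M"
    by (rule tendsto_upperbound) (use eps in \<open>auto simp: eventually_at_right_field intro: exI[of _ 1]\<close>)
  then show ?thesis by (simp add: exp_minus field_simps)
qed

section \<open>Slices of quaternionic functions\<close>

lemma vector_4:
  "(vector [a, b, c, d] :: real ^ 4) $ 1 = a" "(vector [a, b, c, d] :: real ^ 4) $ 2 = b"
  "(vector [a, b, c, d] :: real ^ 4) $ 3 = c" "(vector [a, b, c, d] :: real ^ 4) $ 4 = d"
  unfolding vector_def by simp_all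

lemma qmult_nth:
  "qmult p q $ 1 = p$1 * q$1 - p$2 * q$2 - p$3 * q$3 - p$4 * q$4"
  "qmult p q $ 2 = p$1 * q$2 + p$2 * q$1 + p$3 * q$4 - p$4 * q$3"
  "qmult p q $ 3 = p$1 * q$3 - p$2 * q$4 + p$3 * q$1 + p$4 * q$2"
  "qmult p q $ 4 = p$1 * q$4 + p$2 * q$3 - p$3 * q$2 + p$4 * q$1"
  by (simp_all add: qmult_def vector_4)

lemma inner_quat:
  fixes p q :: quat
  shows "p \<bullet> q = p$1 * q$1 + p$2 * q$2 + p$3 * q$3 + p$4 * q$4"
  by (simp add: inner_vec_def sum_4)

text \<open>Skewness here and orthogonality in \<open>inner_qmult_qmult\<close> make left
  multiplication by \<open>I\<close> a complex structure compatible with the inner product.\<close>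

lemma inner_qmult_skew:
  assumes "I \<in> imag_units"
  shows "qmult I p \<bullet> q = - (p \<bullet> qmult I q)"
  using assms by (simp add: imag_units_def inner_quat qmult_nth algebra_simps)

lemma inner_qmult_qmult:
  assumes "I \<in> imag_units"
  shows "qmult I p \<bullet> qmult I q = p \<bullet> q"
proof -
  have I: "I$1 = 0" "(I$2)\<^sup>2 + (I$3)\<^sup>2 + (I$4)\<^sup>2 = 1" using assms by (auto simp: imag_units_def)
  have "qmult I p \<bullet> qmult I q = ((I$2)\<^sup>2 + (I$3)\<^sup>2 + (I$4)\<^sup>2) * (p \<bullet> q)"
    unfolding inner_quat qmult_nth I(1) by (simp add: algebra_simps power2_eq_square)
  then show ?thesis using I(2) by simp
qed

definition slice_embed :: "quat \<Rightarrow> complex \<Rightarrow> quat" where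
  "slice_embed I z = qreal (Re z) + Im z *\<^sub>R I"

lemma qreal_eq_scaleR: "qreal x = x *\<^sub>R qreal 1"
  by (simp add: qreal_def vec_eq_iff forall_4 vector_4)

lemma continuous_on_slice_embed [continuous_intros]:
  "continuous_on A g \<Longrightarrow> continuous_on A (\<lambda>x. slice_embed I (g x))"
  unfolding slice_embed_def by (subst qreal_eq_scaleR) (intro continuous_intros)

lemma norm_slice_embed:
  assumes "I \<in> imag_units"
  shows "norm (slice_embed I z) = norm z"
proof -
  have "I$1 = 0" using assms by (simp add: imag_units_def)
  then have "(norm (slice_embed I z))\<^sup>2 = (Re z)\<^sup>2 + (Im z)\<^sup>2 * ((I$2)\<^sup>2 + (I$3)\<^sup>2 + (I$4)\<^sup>2)"
    unfolding power2_norm_eq_inner inner_quat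
    by (simp add: slice_embed_def qreal_def vector_4 power2_eq_square algebra_simps)
  also have "\<dots> = (norm z)\<^sup>2" using assms by (simp add: imag_units_def cmod_power2)
  finally show ?thesis by (simp add: power2_eq_iff_nonneg)
qed

lemma slice_embed_diff: "slice_embed I (z - w) = slice_embed I z - slice_embed I w"
  by (subst (1 2 3) slice_embed_def, subst (1 2 3) qreal_eq_scaleR) (simp add: algebra_simps)

lemma slice_embed_eq_iff:
  assumes "I \<in> imag_units"
  shows "slice_embed I z = slice_embed I w \<longleftrightarrow> z = w"
  using norm_slice_embed[OF assms, of "z - w"] by (auto simp: slice_embed_diff)

lemma slice_embed_polar: "slice_embed I (of_real r * cis t) = r *\<^sub>R qexpI I t"
  unfolding slice_embed_def qexpI_def
  by (subst (1 2) qreal_eq_scaleR) (simp add: scaleR_add_right)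

text \<open>The projection of \<open>q\<close> to the complex line spanned by the unit vector \<open>v\<close>, for the complex
  structure given by left multiplication with \<open>I\<close>. Composing with it turns slice regular functions
  into scalar holomorphic ones.\<close>

definition slice_coord :: "quat \<Rightarrow> quat \<Rightarrow> quat \<Rightarrow> complex" where
  "slice_coord I v q = Complex (q \<bullet> v) (q \<bullet> qmult I v)"

lemma bounded_linear_slice_coord: "bounded_linear (slice_coord I v)"
proof -
  have "linear (slice_coord I v)"
    by (rule linearI) (auto simp: slice_coord_def complex_eq_iff inner_add_left)
  then show ?thesis by (simp add: linear_conv_bounded_linear)
qed

text \<open>Complex linearity of the coordinate; it turns \<open>Dx + qmult I Dy = 0\<close> into
  the Cauchy-Riemann equation.\<close>

lemma slice_coord_qmult:
  assumes "I \<in> imag_units"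
  shows "slice_coord I v (qmult I q) = \<i> * slice_coord I v q"
  using inner_qmult_skew[OF assms] inner_qmult_qmult[OF assms]
  by (simp add: slice_coord_def complex_eq_iff)

text \<open>Bessel's inequality for the orthonormal pair \<open>v\<close>,
  \<open>qmult I v\<close>.\<close>

lemma norm_slice_coord_le:
  assumes "I \<in> imag_units" "norm v = 1"
  shows "norm (slice_coord I v q) \<le> norm q"
proof -
  let ?w = "qmult I v"
  have vv: "v \<bullet> v = 1" using assms(2) by (simp add: norm_eq_1)
  have ww: "?w \<bullet> ?w = 1" using inner_qmult_qmult[OF assms(1), of v v] vv by simp
  have vw: "v \<bullet> ?w = 0" "?w \<bullet> v = 0" using inner_qmult_skew[OF assms(1), of v v] by (auto simp: inner_commute)
  have "0 \<le> (q - (q \<bullet> v) *\<^sub>R v - (q \<bullet> ?w) *\<^sub>R ?w) \<bullet> (q - (q \<bullet> v) *\<^sub>R v - (q \<bullet> ?w) *\<^sub>R ?w)"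
    by (rule inner_ge_zero)
  also have "\<dots> = q \<bullet> q - (q \<bullet> v)\<^sup>2 - (q \<bullet> ?w)\<^sup>2"
    by (simp add: inner_diff_left inner_diff_right vv ww vw power2_eq_square inner_commute[of v q] inner_commute[of ?w q])
  finally have "(norm (slice_coord I v q))\<^sup>2 \<le> (norm q)\<^sup>2"
    by (simp add: slice_coord_def cmod_power2 power2_norm_eq_inner)
  then show ?thesis by (rule power2_le_imp_le) simp
qed

lemma slice_coord_self:
  assumes "I \<in> imag_units" "q \<noteq> 0"
  shows "norm (q /\<^sub>R norm q) = 1" "norm q \<le> norm (slice_coord I (q /\<^sub>R norm q) q)"
proof -
  show "norm (q /\<^sub>R norm q) = 1" using assms(2) by simp
  have "norm q = Re (slice_coord I (q /\<^sub>R norm q) q)"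
    using assms(2) by (simp add: slice_coord_def power2_norm_eq_inner[symmetric] power2_eq_square)
  also have "\<dots> \<le> norm (slice_coord I (q /\<^sub>R norm q) q)" by (rule complex_Re_le_cmod)
  finally show "norm q \<le> norm (slice_coord I (q /\<^sub>R norm q) q)" .
qed

lemma slice_regular_imp_holomorphic:
  assumes reg: "slice_regular f \<Omega>" and cont: "continuous_on \<Omega> f" and I: "I \<in> imag_units"
  shows "(\<lambda>z. slice_coord I v (f (slice_embed I z))) holomorphic_on {z. slice_embed I z \<in> \<Omega>}"
proof (rule looman_menchoff)
  have \<Omega>: "open \<Omega>" using reg by (simp add: slice_regular_def)
  have "open (slice_embed I -` \<Omega>)"
    by (rule open_vimage[OF \<Omega>]) (intro continuous_intros)
  then show "open {z. slice_embed I z \<in> \<Omega>}" by (simp add: vimage_def)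
  show "continuous_on {z. slice_embed I z \<in> \<Omega>} (\<lambda>z. slice_coord I v (f (slice_embed I z)))"
    by (intro bounded_linear.continuous_on[OF bounded_linear_slice_coord] continuous_on_compose2[OF cont] continuous_intros) auto
  fix z assume "z \<in> {z. slice_embed I z \<in> \<Omega>}"
  then have "qreal (Re z) + Im z *\<^sub>R I \<in> \<Omega>" by (simp add: slice_embed_def)
  with reg I obtain Dx Dy where
    D: "((\<lambda>t. f (qreal (Re z + t) + Im z *\<^sub>R I)) has_vector_derivative Dx) (at 0)"
      "((\<lambda>t. f (qreal (Re z) + (Im z + t) *\<^sub>R I)) has_vector_derivative Dy) (at 0)"
      "(1/2) *\<^sub>R (Dx + qmult I Dy) = 0" unfolding slice_regular_def by blast
  let ?L = "slice_coord I v"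
  interpret L: bounded_linear ?L by (rule bounded_linear_slice_coord)
  have "Dx + qmult I Dy = 0" using D(3) by simp
  then have "?L Dx + \<i> * ?L Dy = 0"
    using L.add[of Dx "qmult I Dy"] by (simp add: slice_coord_qmult[OF I] L.zero)
  moreover have "((\<lambda>t. ?L (f (slice_embed I (z + of_real t)))) has_vector_derivative ?L Dx) (at 0)"
    using L.has_vector_derivative[OF D(1)] by (simp add: slice_embed_def)
  moreover have "((\<lambda>t. ?L (f (slice_embed I (z + \<i> * of_real t)))) has_vector_derivative ?L Dy) (at 0)"
    using L.has_vector_derivative[OF D(2)] by (simp add: slice_embed_def)
  ultimately show "\<exists>Dx Dy. ((\<lambda>t. ?L (f (slice_embed I (z + of_real t)))) has_vector_derivative Dx) (at 0) \<and>
      ((\<lambda>t. ?L (f (slice_embed I (z + \<i> * of_real t)))) has_vector_derivative Dy) (at 0) \<and> Dx + \<i> * Dy = 0"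
    by blast
qed

section \<open>Exponential bounds from the type\<close>

lemma norm_le_max_modulus:
  assumes "continuous_on (closure \<Omega>) f" "q \<in> closure \<Omega>"
  shows "norm (f q) \<le> max_modulus f \<Omega> (norm q)"
  unfolding max_modulus_def
proof (rule cSUP_upper)
  have "compact (closure \<Omega> \<inter> sphere 0 (norm q))" by (intro closed_Int_compact) auto
  then have "compact ((\<lambda>q. norm (f q)) ` (closure \<Omega> \<inter> sphere 0 (norm q)))"
    using assms(1) by (intro compact_continuous_image continuous_on_norm) (auto intro: continuous_on_subset)
  then have "bdd_above ((\<lambda>q. norm (f q)) ` (closure \<Omega> \<inter> sphere 0 (norm q)))"
    by (intro bounded_imp_bdd_above compact_imp_bounded)
  moreover have "closure \<Omega> \<inter> sphere 0 (norm q) = {p \<in> closure \<Omega>. norm p = norm q}" by auto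
  ultimately show "bdd_above ((\<lambda>q. norm (f q)) ` {p \<in> closure \<Omega>. norm p = norm q})" by simp
qed (use assms in auto)

lemma le_exp_if_lnp_le:
  assumes "lnp x \<le> y" shows "x \<le> exp y"
proof (cases "x \<le> 1")
  case True
  then have "0 \<le> y" using assms by (simp add: lnp_def)
  then have "1 \<le> exp y" by simp
  then show ?thesis using True by linarith
next
  case False
  then have "ln x \<le> y" using assms by (simp add: lnp_def)
  then show ?thesis using False by (metis exp_le_cancel_iff exp_ln less_trans not_le zero_less_one)
qed

text \<open>The limes superior controls \<open>f\<close> only for large \<open>norm q\<close>. On
  the remaining compact part \<open>f\<close> is bounded, and the constant absorbs this because the
  exponential is at least 1.\<close>

lemma norm_le_of_type:
  assumes cont: "continuous_on (closure \<Omega>) f" and type: "type_of f \<Omega> \<rho> = ereal \<sigma>" and "\<sigma> \<ge> 0" "\<epsilon> > 0"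
  obtains C where "\<And>q. q \<in> closure \<Omega> \<Longrightarrow> norm (f q) \<le> C * exp ((\<sigma> + \<epsilon>) * norm q powr \<rho>)"
proof -
  have "Limsup at_top (\<lambda>r. ereal (lnp (max_modulus f \<Omega> r) / r powr \<rho>)) < ereal (\<sigma> + \<epsilon>)"
    using type \<open>\<epsilon> > 0\<close> by (simp add: type_of_def)
  from Limsup_lessD[OF this] obtain R0 where
    R0: "\<And>r. r \<ge> R0 \<Longrightarrow> lnp (max_modulus f \<Omega> r) / r powr \<rho> < \<sigma> + \<epsilon>"
    by (auto simp: eventually_at_top_linorder)
  \<comment> \<open>\<open>R \<ge> 1\<close> makes \<open>r powr \<rho>\<close> positive, so the
    quotient bound can be multiplied out.\<close>
  define R where "R = max R0 1"
  have R: "lnp (max_modulus f \<Omega> r) \<le> (\<sigma> + \<epsilon>) * r powr \<rho>" if "r \<ge> R" for r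
    using R0[of r] that by (simp add: R_def pos_divide_less_eq less_imp_le)
  have "compact (closure \<Omega> \<inter> cball 0 R)" by (intro closed_Int_compact) auto
  then have "bounded (f ` (closure \<Omega> \<inter> cball 0 R))"
    using cont by (intro compact_imp_bounded compact_continuous_image) (auto intro: continuous_on_subset)
  then obtain B where "\<forall>x\<in>f ` (closure \<Omega> \<inter> cball 0 R). norm x \<le> B"
    unfolding bounded_iff by blast
  then have B: "norm (f q) \<le> B" if "q \<in> closure \<Omega>" "norm q \<le> R" for q using that by auto
  show ?thesis
  proof (rule that[of "max B 1"])
    fix q assume q: "q \<in> closure \<Omega>"
    let ?e = "exp ((\<sigma> + \<epsilon>) * norm q powr \<rho>)"
    have e: "1 \<le> ?e" using assms(3,4) by simp
    show "norm (f q) \<le> max B 1 * ?e"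
    proof (cases "norm q \<le> R")
      case True
      have "norm (f q) \<le> max B 1 * 1" using B[OF q True] by simp
      also have "\<dots> \<le> max B 1 * ?e" using e by (intro mult_left_mono) auto
      finally show ?thesis .
    next
      case False
      have "norm (f q) \<le> ?e"
        using norm_le_max_modulus[OF cont q] le_exp_if_lnp_le[OF R[of "norm q"]] False by linarith
      also have "\<dots> \<le> max B 1 * ?e" using e by (simp add: mult_le_cancel_right1)
      finally show ?thesis .
    qed
  qed
qed

lemma type_of_nonneg: "0 \<le> type_of f \<Omega> \<rho>"
  unfolding type_of_def
  by (rule le_Limsup) (auto intro!: always_eventually divide_nonneg_nonneg simp: lnp_def)

section \<open>From the sector in a slice to the strip\<close>

theorem theorem4p6:
  fixes \<Omega> :: "quat set" and f :: "quat \<Rightarrow> quat"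
    and \<zeta> \<phi> :: "quat \<Rightarrow> real" and \<rho> \<sigma> M :: real
  assumes ang: "angular_domain \<Omega>"
    and sect: "\<forall>I\<in>imag_units. 0 < \<phi> I \<and> \<phi> I < 2 * pi \<and>
                  \<Omega> \<inter> slice_plane I = sector I (\<zeta> I) (\<phi> I)"
    and rho_pos: "\<rho> > 0"
    and reg: "slice_regular f \<Omega>"
    and cont: "continuous_on (closure \<Omega>) f"
    and order_rho: "order_of f \<Omega> = ereal \<rho>"
    and type_sigma: "type_of f \<Omega> \<rho> = ereal \<sigma>"
    and opening_le: "(SUP I\<in>imag_units. \<phi> I) \<le> pi / \<rho>"
    and bdry: "\<forall>q\<in>frontier \<Omega>. norm (f q) \<le> M"
  shows "\<forall>I\<in>imag_units. \<forall>r \<theta>. r > 0 \<and> \<bar>\<theta>\<bar> < \<phi> I / 2 \<longrightarrow>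
           norm (f (r *\<^sub>R qexpI I (\<zeta> I + \<theta>))) \<le> M * exp (\<sigma> * r powr \<rho> * cos (\<rho> * \<theta>))"
proof (intro ballI allI impI)
  fix I and r \<theta> :: real
  assume I: "I \<in> imag_units" and r\<theta>: "r > 0 \<and> \<bar>\<theta>\<bar> < \<phi> I / 2"
  have \<phi>: "0 < \<phi> I" "\<phi> I < 2 * pi" and sec: "\<Omega> \<inter> slice_plane I = sector I (\<zeta> I) (\<phi> I)"
    using sect I by auto
  \<comment> \<open>A real supremum dominates its members only for sets bounded above; here
    \<open>2 * pi\<close> is a bound.\<close>
  have "bdd_above (\<phi> ` imag_units)" using sect by (intro bdd_aboveI2[where M="2 * pi"]) auto
  then have "\<phi> I \<le> (SUP I\<in>imag_units. \<phi> I)" using I by (intro cSUP_upper)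
  then have "\<phi> I \<le> pi / \<rho>" using opening_le by linarith
  then have \<rho>\<phi>: "\<rho> * \<phi> I \<le> pi" using rho_pos by (simp add: field_simps)
  have \<Omega>: "open \<Omega>" using reg by (simp add: slice_regular_def)
  have \<sigma>: "\<sigma> \<ge> 0" using type_of_nonneg[of f \<Omega> \<rho>] by (simp add: type_sigma)
  \<comment> \<open>Logarithmic coordinate, rotated so that the bisector of the sector becomes the
    real axis.\<close>
  define z where "z w = exp w * cis (\<zeta> I)" for w
  define p where "p w = slice_embed I (z w)" for w
  have p: "p w = exp (Re w) *\<^sub>R qexpI I (\<zeta> I + Im w)" for w
  proof -
    have "z w = of_real (exp (Re w)) * cis (\<zeta> I + Im w)"
      by (simp add: z_def exp_eq_polar mult.assoc cis_mult add.commute)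
    then show ?thesis unfolding p_def by (simp only: slice_embed_polar)
  qed
  have np: "norm (p w) = exp (Re w)" for w
    by (simp add: p_def norm_slice_embed[OF I] z_def norm_mult)
  have contp: "continuous_on A p" for A
    unfolding p_def z_def by (intro continuous_intros)
  have inside: "p w \<in> \<Omega>" if "\<bar>Im w\<bar> < \<phi> I / 2" for w
  proof -
    have "p w \<in> sector I (\<zeta> I) (\<phi> I)"
      unfolding p sector_def using that by (intro CollectI exI[of _ "exp (Re w)"] exI[of _ "Im w"]) auto
    then show ?thesis using sec by blast
  qed
  \<comment> \<open>A point of the closed strip is the limit of points whose imaginary part is
    scaled by \<open>s < 1\<close>; these are mapped into \<Omega>.\<close>
  have cl: "p w \<in> closure \<Omega>" if w: "\<bar>Im w\<bar> \<le> \<phi> I / 2" for w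
  proof (rule Lim_in_closed_set[OF closed_closure])
    let ?g = "\<lambda>s. p (Complex (Re w) (s * Im w))"
    have "isCont p w" for w using contp[of UNIV] by (simp add: continuous_on_eq_continuous_at)
    moreover have "((\<lambda>s. Complex (Re w) (s * Im w)) \<longlongrightarrow> Complex (Re w) (1 * Im w)) (at_left 1)"
      unfolding Complex_eq by (intro tendsto_intros)
    ultimately show "(?g \<longlongrightarrow> p w) (at_left 1)"
      using isCont_tendsto_compose by fastforce
    have "\<forall>\<^sub>F s in at_left (1::real). s \<in> {0<..<1}" by (intro eventually_at_leftI[of 0]) auto
    then show "\<forall>\<^sub>F s in at_left 1. ?g s \<in> closure \<Omega>"
    proof eventually_elim
      case (elim s)
      have "s * \<bar>Im w\<bar> < \<phi> I / 2"
      proof (cases "Im w = 0")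
        case False
        then have "s * \<bar>Im w\<bar> < 1 * \<bar>Im w\<bar>" using elim by (intro mult_strict_right_mono) auto
        then show ?thesis using w by simp
      qed (use \<phi> in simp)
      then have "?g s \<in> \<Omega>" using elim by (intro inside) (simp add: abs_mult)
      then show ?case using closure_subset by blast
    qed
  qed simp
  \<comment> \<open>If an edge point lay in \<Omega>, it would also have an argument
    \<open>t\<close> in the open sector. Then \<open>t\<close> and \<open>Im w\<close> differ by a
    multiple of \<open>2 * pi\<close>, but by less than \<open>2 * pi\<close> since
    \<open>\<phi> I < 2 * pi\<close>. Hence they are equal, which is impossible.\<close>
  have edge: "p w \<in> frontier \<Omega>" if w: "\<bar>Im w\<bar> = \<phi> I / 2" for w
  proof -
    have "p w \<notin> \<Omega>"
    proof
      assume "p w \<in> \<Omega>"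
      moreover have "p w \<in> slice_plane I" by (auto simp: p_def slice_embed_def slice_plane_def)
      ultimately have "p w \<in> sector I (\<zeta> I) (\<phi> I)" using sec by blast
      then obtain s t where st: "p w = s *\<^sub>R qexpI I (\<zeta> I + t)" "s > 0" "\<bar>t\<bar> < \<phi> I / 2"
        by (auto simp: sector_def)
      define u where "u = Complex (ln s) t"
      have "p u = p w" using st(1,2) p[of u] by (simp add: u_def)
      then have "exp u = exp w" by (simp add: p_def slice_embed_eq_iff[OF I] z_def)
      then obtain n where n: "u = w + of_int (2 * n) * (of_real pi * \<i>)"
        unfolding exp_eq by auto
      then have "t = Im w + 2 * of_int n * pi" by (auto simp: u_def complex_eq_iff)
      moreover have "\<bar>t - Im w\<bar> < 2 * pi" using st(3) w \<phi> by linarith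
      ultimately have "\<bar>2 * of_int n * pi\<bar> < 2 * pi" by simp
      then have "\<bar>real_of_int n\<bar> < 1" by (simp add: abs_mult)
      then have "n = 0" by linarith
      then show False using \<open>t = Im w + 2 * of_int n * pi\<close> st w by auto
    qed
    then show ?thesis using cl[of w] w \<Omega> by (simp add: frontier_def interior_open)
  qed
  \<comment> \<open>The frontier is nonempty, as it contains an edge point; this settles the zeros
    of \<open>f\<close>, where no unit vector \<open>v\<close> is available.\<close>
  have M: "M \<ge> 0"
    using bdry edge[of "Complex 0 (\<phi> I / 2)"] \<phi> norm_ge_zero order_trans
    by (metis abs_of_pos complex.sel(2) half_gt_zero)
  define w0 where "w0 = Complex (ln r) \<theta>"
  have pw0: "p w0 = r *\<^sub>R qexpI I (\<zeta> I + \<theta>)" using r\<theta> by (simp add: p w0_def)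
  show "norm (f (r *\<^sub>R qexpI I (\<zeta> I + \<theta>))) \<le> M * exp (\<sigma> * r powr \<rho> * cos (\<rho> * \<theta>))"
  proof (cases "f (p w0) = 0")
    case True
    then show ?thesis using M by (simp add: pw0)
  next
    case False
    define v where "v = f (p w0) /\<^sub>R norm (f (p w0))"
    have v: "norm v = 1" "norm (f (p w0)) \<le> norm (slice_coord I v (f (p w0)))"
      using slice_coord_self[OF I False] by (auto simp: v_def)
    define H where "H w = slice_coord I v (f (p w))" for w
    have HL: "norm (H w) \<le> norm (f (p w))" for w
      unfolding H_def by (rule norm_slice_coord_le[OF I v(1)])
    have "norm (H w0) \<le> M * exp (\<sigma> * exp (\<rho> * Re w0) * cos (\<rho> * Im w0))"
    proof (rule phragmen_lindelof_strip_type[OF \<phi>(1) rho_pos \<rho>\<phi> \<sigma>])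
      show "continuous_on {w. - \<phi> I / 2 \<le> Im w \<and> Im w \<le> \<phi> I / 2} H"
        unfolding H_def
        by (intro bounded_linear.continuous_on[OF bounded_linear_slice_coord] continuous_on_compose2[OF cont contp])
           (auto intro!: cl simp: abs_le_iff)
      have "(\<lambda>z. slice_coord I v (f (slice_embed I z))) holomorphic_on {z. slice_embed I z \<in> \<Omega>}"
        by (rule slice_regular_imp_holomorphic[OF reg continuous_on_subset[OF cont closure_subset] I])
      moreover have "z holomorphic_on {w. - \<phi> I / 2 < Im w \<and> Im w < \<phi> I / 2}"
        unfolding z_def by (intro holomorphic_intros)
      moreover have "z ` {w. - \<phi> I / 2 < Im w \<and> Im w < \<phi> I / 2} \<subseteq> {z. slice_embed I z \<in> \<Omega>}"
        using inside by (auto simp: p_def abs_less_iff)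
      ultimately have "((\<lambda>z. slice_coord I v (f (slice_embed I z))) \<circ> z) holomorphic_on {w. - \<phi> I / 2 < Im w \<and> Im w < \<phi> I / 2}"
        by (intro holomorphic_on_compose_gen)
      then show "H holomorphic_on {w. - \<phi> I / 2 < Im w \<and> Im w < \<phi> I / 2}"
        by (simp add: H_def[abs_def] p_def o_def)
      show "norm (H w) \<le> M" if "\<bar>Im w\<bar> = \<phi> I / 2" for w
        using HL[of w] bdry edge[OF that] by (meson order_trans)
      show "\<exists>C. \<forall>w. \<bar>Im w\<bar> \<le> \<phi> I / 2 \<longrightarrow> norm (H w) \<le> C * exp ((\<sigma> + \<epsilon>) * exp (\<rho> * Re w))" if \<epsilon>: "\<epsilon> > 0" for \<epsilon>
      proof -
        obtain C where C: "\<And>q. q \<in> closure \<Omega> \<Longrightarrow> norm (f q) \<le> C * exp ((\<sigma> + \<epsilon>) * norm q powr \<rho>)"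
          using norm_le_of_type[OF cont type_sigma \<sigma> \<epsilon>] by blast
        have "norm (H w) \<le> C * exp ((\<sigma> + \<epsilon>) * exp (\<rho> * Re w))" if "\<bar>Im w\<bar> \<le> \<phi> I / 2" for w
          using HL[of w] C[OF cl[OF that]] by (simp add: np powr_def mult.commute)
        then show ?thesis by blast
      qed
    qed (use r\<theta> in \<open>auto simp: w0_def\<close>)
    also have "exp (\<rho> * Re w0) = r powr \<rho>" using r\<theta> by (simp add: w0_def powr_def)
    finally have "norm (f (p w0)) \<le> M * exp (\<sigma> * r powr \<rho> * cos (\<rho> * Im w0))"
      using v(2) unfolding H_def by linarith
    then show ?thesis unfolding pw0 by (simp add: w0_def)
  qed
qed

end
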